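(* Let $X$ be a finite dataset, and fix $k\in\mathbb{Z}$, a collection of bins $\mathbb{B}$ of $X$, and $\epsilon\in\mathbb{R}$. Let $MinPts_0\ge MinPts_1\ge\dots\ge MinPts_m$ be positive integers, and for each $i$ let DBSCAN with parameters $\epsilon$ and $MinPts_i$ be used to cluster each bin of $\mathbb{B}$, giving the cluster cover $\mathbb{C}_{MinPts_i}$. Suppose that for each $i$ there are no free-border points with respect to $\epsilon$ and $MinPts_i$ (in any bin of $\mathbb{B}$). Then: (1) there is a filtration of simplicial complexes $\{\phi^{MinPts_i,MinPts_j}:\mathbb{N}(\mathbb{C}_{MinPts_i})\to\mathbb{N}(\mathbb{C}_{MinPts_j}),\ \forall\,MinPts_i\ge MinPts_j\}$, induced by a filtration of the cluster covers $\mathbb{C}_{MinPts_i}$, where $\mathbb{N}(\mathbb{C}_{MinPts_i})$ is the nerve whose vertices are the clusters with respect to $\epsilon$ and $MinPts_i$; (2) there is an induced filtration of homology groups $\{f^{MinPts_i,MinPts_j}:H_k(\mathbb{N}(\mathbb{C}_{MinPts_i}))\to H_k(\mathbb{N}(\mathbb{C}_{MinPts_j})),\ \forall\,MinPts_i\ge MinPts_j\}$.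
   Context: DBSCAN. Let $Y$ be a finite (ordered) set of points in a metric space, $\epsilon\in\mathbb{R}$, $MinPts$ a positive integer, and $N_\epsilon(p)=\{q\in Y: dist(p,q)\le\epsilon\}$ for $p\in Y$. A point $p\in Y$ is a core point if $|N_\epsilon(p)|\ge MinPts$; a border point if it is not core but lies in $N_\epsilon(p')$ for some core point $p'$; and noise otherwise. A point $q$ is directly density-reachable from $p$ if $p$ is core and $q\in N_\epsilon(p)$. A point $q$ is density-reachable from $p$ if there are points $p=\alpha_1,\dots,\alpha_n=q$ in $Y$, $n\ge 2$, with each $\alpha_{i+1}$ directly density-reachable from $\alpha_i$. Points $p,q$ are density-connected if there is a point $o\in Y$ from which both are density-reachable. DBSCAN outputs a partition $Y=C_1\sqcup\dots\sqcup C_n\sqcup N$, with $N$ the set of noise points and the clusters $C_i$, each containing at least one core point, satisfying: (Maximality) if $p\in C_i$, $q\notin \bigsqcup_{j<i}C_j$ and $q$ is density-reachable from $p$, then $q\in C_i$; (Connectivity) any $p,q\in C_i$ are density-connected. The assignment of some border points may depend on the ordering of $Y$. A point $s\in Y$ is a free-border point with respect to $\epsilon$ and $MinPts$ if $|N_\epsilon(s)|<MinPts$ and there are core points $p,q\in Y$ with $s\in N_\epsilon(p)$, $s\in N_\epsilon(q)$ and $p$ not density-connected to $q$. Bins and cluster covers. A bin is a subset of $X$; $\mathbb{B}$ is a finite indexed collection of bins covering $X$. DBSCAN is run separately inside each bin (with $Y$ = the bin). The cluster cover is the family of all clusters so obtained, indexed by the bin they come from (clusters in different bins are different elements even if equal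 as sets); noise points belong to no cluster, and the word "cover" is used regardless. Filtrations. A family $\{\mathbb{U}_\lambda\}$ of (cluster) covers indexed by a partially ordered parameter set is a filtration if it has maps $u^{\lambda,\mu}:\mathbb{U}_\lambda\to\mathbb{U}_\mu$ for $\lambda\le\mu$ such that $u^{\lambda,\mu}(U)=V$ implies $U\subseteq V$, and $u^{\mu,\nu}\circ u^{\lambda,\mu}=u^{\lambda,\nu}$ for $\lambda\le\mu\le\nu$. Here the parameter is $MinPts$ with the reversed order. The nerve $\mathbb{N}(\mathbb{U})$ of an indexed family $\mathbb{U}=\{U_\alpha\}_{\alpha\in A}$ is the simplicial complex with vertex set $A$ in which $\{\alpha_0,\dots,\alpha_n\}$ is a simplex iff $U_{\alpha_0}\cap\dots\cap U_{\alpha_n}\ne\emptyset$. A filtration of simplicial complexes (resp. homology groups) is a family of simplicial maps (resp. homomorphisms) $\phi^{\lambda,\mu}$ for $\lambda\le\mu$ with $\phi^{\mu,\nu}\circ\phi^{\lambda,\mu}=\phi^{\lambda,\nu}$. It is induced by a filtration of cluster covers if the simplicial maps act on vertices by the maps of the cluster-cover filtration, and the homomorphisms are the maps induced on $H_k$ by these simplicial maps. Homology is simplicial, with a fixed coefficient group. *)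

theory Defs
  imports Complex_Main "HOL-Library.Poly_Mapping" "HOL-Combinatorics.Permutations" "HOL-Algebra.Coset"
begin

section \<open>DBSCAN\<close>

definition eps_nbhd :: "real \<Rightarrow> 'a::metric_space set \<Rightarrow> 'a \<Rightarrow> 'a set" where
  "eps_nbhd \<epsilon> Y p = {q \<in> Y. dist p q \<le> \<epsilon>}"

definition core_point :: "real \<Rightarrow> nat \<Rightarrow> 'a::metric_space set \<Rightarrow> 'a \<Rightarrow> bool" where
  "core_point \<epsilon> M Y p \<longleftrightarrow> p \<in> Y \<and> card (eps_nbhd \<epsilon> Y p) \<ge> M"

definition border_point :: "real \<Rightarrow> nat \<Rightarrow> 'a::metric_space set \<Rightarrow> 'a \<Rightarrow> bool" where
  "border_point \<epsilon> M Y p \<longleftrightarrow>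
     p \<in> Y \<and> \<not> core_point \<epsilon> M Y p \<and> (\<exists>p'. core_point \<epsilon> M Y p' \<and> p \<in> eps_nbhd \<epsilon> Y p')"

definition noise_points :: "real \<Rightarrow> nat \<Rightarrow> 'a::metric_space set \<Rightarrow> 'a set" where
  "noise_points \<epsilon> M Y = {p \<in> Y. \<not> core_point \<epsilon> M Y p \<and> \<not> border_point \<epsilon> M Y p}"

text \<open>In the next two definitions it is the last argument that is reachable from the
  last but one. The chains \<open>p = \<alpha>\<^sub>1, \<dots>, \<alpha>\<^sub>n = q\<close> in the definition of density-reachability
  have \<open>n \<ge> 2\<close>, whence the transitive, not reflexive, closure.\<close>

definition directly_density_reachable ::
    "real \<Rightarrow> nat \<Rightarrow> 'a::metric_space set \<Rightarrow> 'a \<Rightarrow> 'a \<Rightarrow> bool" where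
  "directly_density_reachable \<epsilon> M Y p q \<longleftrightarrow> core_point \<epsilon> M Y p \<and> q \<in> eps_nbhd \<epsilon> Y p"

definition density_reachable ::
    "real \<Rightarrow> nat \<Rightarrow> 'a::metric_space set \<Rightarrow> 'a \<Rightarrow> 'a \<Rightarrow> bool" where
  "density_reachable \<epsilon> M Y = (directly_density_reachable \<epsilon> M Y)\<^sup>+\<^sup>+"

definition density_connected ::
    "real \<Rightarrow> nat \<Rightarrow> 'a::metric_space set \<Rightarrow> 'a \<Rightarrow> 'a \<Rightarrow> bool" where
  "density_connected \<epsilon> M Y p q \<longleftrightarrow>
     (\<exists>r\<in>Y. density_reachable \<epsilon> M Y r p \<and> density_reachable \<epsilon> M Y r q)"

text \<open>The list is the sequence \<open>C\<^sub>1, \<dots>, C\<^sub>n\<close> of clusters in the order in which they are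
  produced. The algorithm may have several outcomes, depending on the ordering of the data;
  the predicate holds for each of them.\<close>

definition dbscan_output ::
    "real \<Rightarrow> nat \<Rightarrow> 'a::metric_space set \<Rightarrow> 'a set list \<Rightarrow> bool" where
  "dbscan_output \<epsilon> M Y Cs \<longleftrightarrow>
     \<Union>(set Cs) \<union> noise_points \<epsilon> M Y = Y \<and>
     \<Union>(set Cs) \<inter> noise_points \<epsilon> M Y = {} \<and>
     (\<forall>i<length Cs. \<forall>j<length Cs. i \<noteq> j \<longrightarrow> Cs ! i \<inter> Cs ! j = {}) \<and>
     (\<forall>C\<in>set Cs. \<exists>p\<in>C. core_point \<epsilon> M Y p) \<and>
     (\<forall>i<length Cs. \<forall>p q. p \<in> Cs ! i \<and> q \<notin> (\<Union>j<i. Cs ! j) \<and> density_reachable \<epsilon> M Y p q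
        \<longrightarrow> q \<in> Cs ! i) \<and>
     (\<forall>C\<in>set Cs. \<forall>p\<in>C. \<forall>q\<in>C. density_connected \<epsilon> M Y p q)"

definition free_border_point :: "real \<Rightarrow> nat \<Rightarrow> 'a::metric_space set \<Rightarrow> 'a \<Rightarrow> bool" where
  "free_border_point \<epsilon> M Y s \<longleftrightarrow>
     s \<in> Y \<and> card (eps_nbhd \<epsilon> Y s) < M \<and>
     (\<exists>p q. core_point \<epsilon> M Y p \<and> core_point \<epsilon> M Y q \<and>
        s \<in> eps_nbhd \<epsilon> Y p \<and> s \<in> eps_nbhd \<epsilon> Y q \<and> \<not> density_connected \<epsilon> M Y p q)"

section \<open>Covers, nerves and filtrations\<close>

text \<open>An indexed family of sets is given by an index set \<open>A\<close> and a function \<open>U\<close> on it. The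
  clusters found in the bins \<open>b \<in> B\<close> form the family with the index set below and \<open>U = snd\<close>:
  equal clusters from different bins remain different members.\<close>

definition cluster_cover :: "'b set \<Rightarrow> ('b \<Rightarrow> 'a set list) \<Rightarrow> ('b \<times> 'a set) set" where
  "cluster_cover B Cl = (SIGMA b:B. set (Cl b))"

record 'v scomplex =
  vertices :: "'v set"
  simplices :: "'v set set"

definition simplicial_complex :: "'v scomplex \<Rightarrow> bool" where
  "simplicial_complex K \<longleftrightarrow>
     (\<forall>s\<in>simplices K. finite s \<and> s \<noteq> {} \<and> s \<subseteq> vertices K) \<and>
     (\<forall>v\<in>vertices K. {v} \<in> simplices K) \<and>
     (\<forall>s\<in>simplices K. \<forall>t. t \<subseteq> s \<and> t \<noteq> {} \<longrightarrow> t \<in> simplices K)"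

definition simplicial_map :: "'v scomplex \<Rightarrow> 'w scomplex \<Rightarrow> ('v \<Rightarrow> 'w) \<Rightarrow> bool" where
  "simplicial_map K L f \<longleftrightarrow>
     f \<in> vertices K \<rightarrow> vertices L \<and> (\<forall>s\<in>simplices K. f ` s \<in> simplices L)"

definition nerve :: "'i set \<Rightarrow> ('i \<Rightarrow> 'a set) \<Rightarrow> 'i scomplex" where
  "nerve A U =
     \<lparr>vertices = A,
      simplices = {s. s \<subseteq> A \<and> finite s \<and> s \<noteq> {} \<and> (\<Inter>\<alpha>\<in>s. U \<alpha>) \<noteq> {}}\<rparr>"

text \<open>Filtrations are indexed by a set \<open>P\<close> with a partial order \<open>R\<close>; the order is an
  argument because the parameter \<open>MinPts\<close> is ordered by \<open>(\<ge>)\<close>.\<close>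

definition cover_filtration ::
    "'p set \<Rightarrow> ('p \<Rightarrow> 'p \<Rightarrow> bool) \<Rightarrow> ('p \<Rightarrow> 'i set) \<Rightarrow> ('p \<Rightarrow> 'i \<Rightarrow> 'a set) \<Rightarrow>
     ('p \<Rightarrow> 'p \<Rightarrow> 'i \<Rightarrow> 'i) \<Rightarrow> bool" where
  "cover_filtration P R A U u \<longleftrightarrow>
     (\<forall>l\<in>P. \<forall>m\<in>P. R l m \<longrightarrow>
        u l m \<in> A l \<rightarrow> A m \<and> (\<forall>\<alpha>\<in>A l. U l \<alpha> \<subseteq> U m (u l m \<alpha>))) \<and>
     (\<forall>l\<in>P. \<forall>m\<in>P. \<forall>n\<in>P. R l m \<and> R m n \<longrightarrow>
        (\<forall>\<alpha>\<in>A l. u m n (u l m \<alpha>) = u l n \<alpha>))"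

definition simplicial_filtration ::
    "'p set \<Rightarrow> ('p \<Rightarrow> 'p \<Rightarrow> bool) \<Rightarrow> ('p \<Rightarrow> 'v scomplex) \<Rightarrow> ('p \<Rightarrow> 'p \<Rightarrow> 'v \<Rightarrow> 'v) \<Rightarrow> bool" where
  "simplicial_filtration P R K \<phi> \<longleftrightarrow>
     (\<forall>l\<in>P. simplicial_complex (K l)) \<and>
     (\<forall>l\<in>P. \<forall>m\<in>P. R l m \<longrightarrow> simplicial_map (K l) (K m) (\<phi> l m)) \<and>
     (\<forall>l\<in>P. \<forall>m\<in>P. \<forall>n\<in>P. R l m \<and> R m n \<longrightarrow>
        (\<forall>v\<in>vertices (K l). \<phi> m n (\<phi> l m v) = \<phi> l n v))"

definition group_filtration ::
    "'p set \<Rightarrow> ('p \<Rightarrow> 'p \<Rightarrow> bool) \<Rightarrow> ('p \<Rightarrow> 'h monoid) \<Rightarrow> ('p \<Rightarrow> 'p \<Rightarrow> 'h \<Rightarrow> 'h) \<Rightarrow> bool" where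
  "group_filtration P R H f \<longleftrightarrow>
     (\<forall>l\<in>P. comm_group (H l)) \<and>
     (\<forall>l\<in>P. \<forall>m\<in>P. R l m \<longrightarrow> f l m \<in> hom (H l) (H m)) \<and>
     (\<forall>l\<in>P. \<forall>m\<in>P. \<forall>n\<in>P. R l m \<and> R m n \<longrightarrow>
        (\<forall>z\<in>carrier (H l). f m n (f l m z) = f l n z))"

section \<open>Simplicial homology\<close>

text \<open>An oriented simplex is represented by any list of its vertices giving the orientation,
  and a \<open>p\<close>-chain is a finitely supported function on oriented \<open>p\<close>-simplices which changes
  sign when the orientation is reversed. The coefficient group is the type \<open>'g\<close>.
  The simplices being nonempty, there are no nonzero chains for \<open>p < 0\<close>.\<close>

definition simplicial_chains ::
    "'v scomplex \<Rightarrow> int \<Rightarrow> ('v list \<Rightarrow>\<^sub>0 'g::ab_group_add) set" where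
  "simplicial_chains K p =
     {c. (\<forall>vs\<in>Poly_Mapping.keys c. distinct vs \<and> set vs \<in> simplices K \<and> int (length vs) = p + 1) \<and>
         (\<forall>vs \<pi>. \<pi> permutes {..<length vs} \<longrightarrow>
            Poly_Mapping.lookup c (permute_list \<pi> vs) = (if evenperm \<pi> then Poly_Mapping.lookup c vs else - Poly_Mapping.lookup c vs))}"

definition simplicial_chain_group ::
    "'v scomplex \<Rightarrow> int \<Rightarrow> ('v list \<Rightarrow>\<^sub>0 'g::ab_group_add) monoid" where
  "simplicial_chain_group K p = \<lparr>carrier = simplicial_chains K p, mult = (+), one = 0\<rparr>"

text \<open>The chain \<open>g [v\<^sub>0, \<dots>, v\<^sub>p]\<close> for distinct vertices.\<close>

definition elementary_chain :: "'g::ab_group_add \<Rightarrow> 'v list \<Rightarrow> ('v list \<Rightarrow>\<^sub>0 'g)" where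
  "elementary_chain g vs =
     (\<Sum>\<pi> | \<pi> permutes {..<length vs}.
        Poly_Mapping.single (permute_list \<pi> vs) (if evenperm \<pi> then g else - g))"

text \<open>The coefficient of \<open>[v\<^sub>1, \<dots>, v\<^sub>p]\<close> in the boundary of \<open>c\<close> is the sum over \<open>v\<close> of the
  coefficients of \<open>[v, v\<^sub>1, \<dots>, v\<^sub>p]\<close> in \<open>c\<close>; that of \<open>[w\<^sub>0, \<dots>, w\<^sub>p]\<close> in the image of \<open>c\<close>
  under the chain map of \<open>f\<close> is the sum over all \<open>[v\<^sub>0, \<dots>, v\<^sub>p]\<close> with \<open>f v\<^sub>i = w\<^sub>i\<close>. The usual
  formulas, with alternating signs, for the values on \<open>[v\<^sub>0, \<dots>, v\<^sub>p]\<close> are derived below.\<close>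

definition simplicial_boundary ::
    "('v list \<Rightarrow>\<^sub>0 'g::ab_group_add) \<Rightarrow> ('v list \<Rightarrow>\<^sub>0 'g)" where
  "simplicial_boundary c =
     (\<Sum>vs\<in>Poly_Mapping.keys c.
        if length vs \<ge> 2 then Poly_Mapping.single (tl vs) (Poly_Mapping.lookup c vs) else 0)"

definition simplicial_chain_map ::
    "('v \<Rightarrow> 'w) \<Rightarrow> ('v list \<Rightarrow>\<^sub>0 'g::ab_group_add) \<Rightarrow> ('w list \<Rightarrow>\<^sub>0 'g)" where
  "simplicial_chain_map f c =
     (\<Sum>vs\<in>Poly_Mapping.keys c.
        if distinct (map f vs) then Poly_Mapping.single (map f vs) (Poly_Mapping.lookup c vs) else 0)"

definition simplicial_cycles ::
    "'v scomplex \<Rightarrow> int \<Rightarrow> ('v list \<Rightarrow>\<^sub>0 'g::ab_group_add) set" where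
  "simplicial_cycles K p =
     kernel (simplicial_chain_group K p) (simplicial_chain_group K (p - 1)) simplicial_boundary"

definition simplicial_boundaries ::
    "'v scomplex \<Rightarrow> int \<Rightarrow> ('v list \<Rightarrow>\<^sub>0 'g::ab_group_add) set" where
  "simplicial_boundaries K p = simplicial_boundary ` simplicial_chains K (p + 1)"

definition simplicial_cycle_group ::
    "'v scomplex \<Rightarrow> int \<Rightarrow> ('v list \<Rightarrow>\<^sub>0 'g::ab_group_add) monoid" where
  "simplicial_cycle_group K p = (simplicial_chain_group K p)\<lparr>carrier := simplicial_cycles K p\<rparr>"

definition simplicial_homology ::
    "'v scomplex \<Rightarrow> int \<Rightarrow> ('v list \<Rightarrow>\<^sub>0 'g::ab_group_add) set monoid" where
  "simplicial_homology K p = simplicial_cycle_group K p Mod simplicial_boundaries K p"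

text \<open>The class of \<open>c\<close> is sent to the class of its image; the union does not depend on
  representatives being chosen.\<close>

definition simplicial_hom_induced ::
    "'w scomplex \<Rightarrow> int \<Rightarrow> ('v \<Rightarrow> 'w) \<Rightarrow>
     ('v list \<Rightarrow>\<^sub>0 'g::ab_group_add) set \<Rightarrow> ('w list \<Rightarrow>\<^sub>0 'g) set" where
  "simplicial_hom_induced L p f z =
     (\<Union>c\<in>z. simplicial_boundaries L p #>\<^bsub>simplicial_cycle_group L p\<^esub> simplicial_chain_map f c)"

section \<open>Induced filtrations\<close>

definition simplicial_filtration_induced ::
    "'p set \<Rightarrow> ('p \<Rightarrow> 'p \<Rightarrow> bool) \<Rightarrow> ('p \<Rightarrow> 'v scomplex) \<Rightarrow>
     ('p \<Rightarrow> 'p \<Rightarrow> 'v \<Rightarrow> 'v) \<Rightarrow> ('p \<Rightarrow> 'p \<Rightarrow> 'v \<Rightarrow> 'v) \<Rightarrow> bool" where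
  "simplicial_filtration_induced P R K u \<phi> \<longleftrightarrow>
     (\<forall>l\<in>P. \<forall>m\<in>P. R l m \<longrightarrow> (\<forall>v\<in>vertices (K l). \<phi> l m v = u l m v))"

definition homology_filtration_induced ::
    "'p set \<Rightarrow> ('p \<Rightarrow> 'p \<Rightarrow> bool) \<Rightarrow> ('p \<Rightarrow> 'v scomplex) \<Rightarrow> int \<Rightarrow> ('p \<Rightarrow> 'p \<Rightarrow> 'v \<Rightarrow> 'v) \<Rightarrow>
     ('p \<Rightarrow> 'p \<Rightarrow> ('v list \<Rightarrow>\<^sub>0 'g::ab_group_add) set \<Rightarrow> ('v list \<Rightarrow>\<^sub>0 'g) set) \<Rightarrow> bool" where
  "homology_filtration_induced P R K k \<phi> f \<longleftrightarrow>
     (\<forall>l\<in>P. \<forall>m\<in>P. R l m \<longrightarrow>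
        (\<forall>z\<in>carrier (simplicial_homology (K l) k). f l m z = simplicial_hom_induced (K m) k (\<phi> l m) z))"

section \<open>The usual formulas for boundaries and chain maps\<close>

text \<open>Below, \<open>if even i then g else - g\<close> is \<open>(-1)\<^sup>i g\<close>, and \<open>take i vs @ drop (Suc i) vs\<close> is
  \<open>vs\<close> with the entry at \<open>i\<close> deleted.\<close>

lemma sum_keys_single_add:
  fixes a b :: "'a \<Rightarrow>\<^sub>0 'g::ab_group_add" and h :: "'a \<Rightarrow> 'b" and Q :: "'a \<Rightarrow> bool"
  defines "F \<equiv> \<lambda>c. \<Sum>x\<in>Poly_Mapping.keys c.
      if Q x then Poly_Mapping.single (h x) (Poly_Mapping.lookup c x) else 0"
  shows "F (a + b) = F a + F b"
proof -
  let ?S = "Poly_Mapping.keys a \<union> Poly_Mapping.keys b"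
  have *: "F c = (\<Sum>x\<in>?S. if Q x then Poly_Mapping.single (h x) (Poly_Mapping.lookup c x) else 0)"
    if "Poly_Mapping.keys c \<subseteq> ?S" for c
    unfolding F_def by (rule sum.mono_neutral_left) (use that in \<open>auto simp: in_keys_iff\<close>)
  show ?thesis
    by (subst (1 2 3) *)
       (auto simp: keys_add single_add lookup_add sum.distrib [symmetric] intro!: sum.cong
             dest: subsetD [OF keys_add])
qed

lemma simplicial_boundary_add:
  "simplicial_boundary (a + b) = simplicial_boundary a + simplicial_boundary b"
  unfolding simplicial_boundary_def by (rule sum_keys_single_add)

lemma simplicial_chain_map_add:
  "simplicial_chain_map f (a + b) = simplicial_chain_map f a + simplicial_chain_map f b"
  unfolding simplicial_chain_map_def by (rule sum_keys_single_add)

lemma simplicial_boundary_sum: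
  "finite I \<Longrightarrow> simplicial_boundary (\<Sum>i\<in>I. c i) = (\<Sum>i\<in>I. simplicial_boundary (c i))"
  by (induction I rule: finite_induct)
     (simp_all add: simplicial_boundary_add, simp add: simplicial_boundary_def)

lemma simplicial_chain_map_sum:
  "finite I \<Longrightarrow> simplicial_chain_map f (\<Sum>i\<in>I. c i) = (\<Sum>i\<in>I. simplicial_chain_map f (c i))"
  by (induction I rule: finite_induct)
     (simp_all add: simplicial_chain_map_add, simp add: simplicial_chain_map_def)

lemma simplicial_boundary_single:
  "simplicial_boundary (Poly_Mapping.single vs g) =
     (if length vs \<ge> 2 then Poly_Mapping.single (tl vs) g else 0)"
  by (simp add: simplicial_boundary_def)

lemma simplicial_chain_map_single:
  "simplicial_chain_map f (Poly_Mapping.single vs g) =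
     (if distinct (map f vs) then Poly_Mapping.single (map f vs) g else 0)"
  by (simp add: simplicial_chain_map_def)

lemma simplicial_chain_map_elementary_chain:
  "simplicial_chain_map f (elementary_chain g vs) =
     (if distinct (map f vs) then elementary_chain g (map f vs) else 0)"
proof -
  have "simplicial_chain_map f (elementary_chain g vs) =
     (\<Sum>\<pi> | \<pi> permutes {..<length vs}.
        if distinct (map f vs)
        then Poly_Mapping.single (permute_list \<pi> (map f vs)) (if evenperm \<pi> then g else - g) else 0)"
    unfolding elementary_chain_def
    by (subst simplicial_chain_map_sum)
       (auto simp: finite_permutations simplicial_chain_map_single permute_list_map [symmetric]
             intro!: sum.cong)
  then show ?thesis
    by (simp add: elementary_chain_def)
qed

lemma shift_permutes:
  assumes "\<sigma> permutes {..<n}"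
  defines "L \<equiv> \<lambda>\<sigma> (j::nat). case j of 0 \<Rightarrow> 0 | Suc i \<Rightarrow> Suc (\<sigma> i)"
  shows "L \<sigma> permutes {..<Suc n} \<and> (evenperm (L \<sigma>) \<longleftrightarrow> evenperm \<sigma>)"
proof -
  show ?thesis
    using assms(1) finite_lessThan
  proof (induction rule: permutes_induct)
    case id
    have "L id = id" by (auto simp: L_def fun_eq_iff split: nat.splits)
    then show ?case by (metis evenperm_id permutes_id)
  next
    case (swap a b p)
    have eq: "L (transpose a b \<circ> p) = transpose (Suc a) (Suc b) \<circ> L p"
      by (auto simp: L_def fun_eq_iff transpose_def split: nat.splits)
    have t: "transpose (Suc a) (Suc b) permutes {..<Suc n}"
      using swap by (intro permutes_swap_id) auto
    have p: "permutation p" "permutation (L p)"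
      using swap permutation_permutes by blast+
    have "L (transpose a b \<circ> p) permutes {..<Suc n}"
      unfolding eq using swap t by (blast intro: permutes_compose)
    moreover have "evenperm (L (transpose a b \<circ> p)) \<longleftrightarrow> evenperm (transpose a b \<circ> p)"
      unfolding eq evenperm_comp [OF permutation_swap_id p(1)] evenperm_comp [OF permutation_swap_id p(2)]
      using swap by (simp add: evenperm_swap)
    ultimately show ?case ..
  qed
qed

lemma cycle_permutes:
  defines "Z \<equiv> \<lambda>i (j::nat). if j = 0 then i else if j \<le> i then j - 1 else j"
  assumes "i < n"
  shows "Z i permutes {..<n} \<and> (evenperm (Z i) \<longleftrightarrow> even i)"
  using assms(2)
proof (induction i)
  case 0
  have "Z 0 = id" by (auto simp: Z_def fun_eq_iff)
  then show ?case by (metis evenperm_id even_zero permutes_id)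
next
  case (Suc i)
  have eq: "Z (Suc i) = transpose i (Suc i) \<circ> Z i"
    by (auto simp: Z_def fun_eq_iff transpose_def)
  have t: "transpose i (Suc i) permutes {..<n}"
    using Suc by (intro permutes_swap_id) auto
  have p: "permutation (Z i)"
    using Suc permutation_permutes by (metis Suc_lessD finite_lessThan)
  have "Z (Suc i) permutes {..<n}"
    unfolding eq by (rule permutes_compose [OF _ t]) (use Suc in simp)
  moreover have "evenperm (Z (Suc i)) \<longleftrightarrow> even (Suc i)"
    unfolding eq evenperm_comp [OF permutation_swap_id p]
    using Suc by (simp add: evenperm_swap)
  ultimately show ?case ..
qed

lemma simplicial_boundary_elementary_chain:
  assumes "length vs \<ge> 2"
  shows "simplicial_boundary (elementary_chain g vs) =
    (\<Sum>i<length vs. elementary_chain (if even i then g else - g) (take i vs @ drop (Suc i) vs))"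
proof -
  obtain n where n: "length vs = Suc n" using assms by (cases vs) auto
  define L where "L = (\<lambda>(\<sigma>::nat \<Rightarrow> nat) j. case j of 0 \<Rightarrow> 0 | Suc i \<Rightarrow> Suc (\<sigma> i))"
  define Z where "Z = (\<lambda>i (j::nat). if j = 0 then i else if j \<le> i then j - 1 else j)"
  define d where "d = (\<lambda>i. take i vs @ drop (Suc i) vs)"
  define S where "S = {..<Suc n} \<times> {\<sigma>. \<sigma> permutes {..<n}}"
  define T where "T = {\<pi>. \<pi> permutes {..<Suc n}}"
  define h where "h = (\<lambda>(i, \<sigma>). Z i \<circ> L \<sigma>)"
  have L: "L \<sigma> permutes {..<Suc n}" "evenperm (L \<sigma>) \<longleftrightarrow> evenperm \<sigma>" if "\<sigma> permutes {..<n}" for \<sigma>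
    using shift_permutes [OF that] unfolding L_def by auto
  have Z: "Z i permutes {..<Suc n}" "evenperm (Z i) \<longleftrightarrow> even i" if "i < Suc n" for i
    using cycle_permutes [OF that] unfolding Z_def by auto
  have fin: "finite S" "finite T"
    by (auto simp: S_def T_def finite_permutations)
  have inj: "inj_on h S"
  proof (rule inj_onI, clarsimp simp: S_def)
    fix i \<sigma> j \<tau>
    assume ij: "i < Suc n" "j < Suc n" and eq: "h (i, \<sigma>) = h (j, \<tau>)"
    have "i = j" using fun_cong [OF eq, of 0] by (simp add: h_def Z_def L_def)
    moreover have "inj (Z i)" using Z(1) [OF ij(1)] permutes_inj by blast
    ultimately have "L \<sigma> x = L \<tau> x" for x
      using fun_cong [OF eq, of x] by (auto simp: h_def dest: injD)
    from this [of "Suc _"] have "\<sigma> = \<tau>" by (auto simp: L_def)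
    then show "i = j \<and> \<sigma> = \<tau>" using \<open>i = j\<close> by simp
  qed
  have sub: "h ` S \<subseteq> T"
    using L(1) Z(1) by (auto simp: h_def S_def T_def intro!: permutes_compose)
  have "card T = fact (Suc n)" "card S = fact (Suc n)"
    using card_permutations [of "{..<Suc n}" "Suc n"] card_permutations [of "{..<n}" n]
    by (auto simp: S_def T_def card_cartesian_product)
  then have hS: "h ` S = T"
    using sub inj fin by (metis card_image card_subset_eq)
  have ev: "evenperm (h (i, \<sigma>)) \<longleftrightarrow> (even i \<longleftrightarrow> evenperm \<sigma>)"
    if "i < Suc n" "\<sigma> permutes {..<n}" for i \<sigma>
    using L [OF that(2)] Z [OF that(1)] unfolding h_def
    by (simp, subst evenperm_comp) (auto intro: permutation_permutes [THEN iffD2])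
  have tl: "tl (permute_list (h (i, \<sigma>)) vs) = permute_list \<sigma> (d i)"
    if "i < Suc n" "\<sigma> permutes {..<n}" for i \<sigma>
  proof (rule nth_equalityI)
    show "length (tl (permute_list (h (i, \<sigma>)) vs)) = length (permute_list \<sigma> (d i))"
      using that n by (simp add: d_def)
    fix j assume "j < length (tl (permute_list (h (i, \<sigma>)) vs))"
    then have j: "j < n" using n by simp
    have s: "\<sigma> j < n" using that(2) j permutes_in_image by fastforce
    have dn: "length (d i) = n" using that n by (simp add: d_def)
    have "tl (permute_list (h (i, \<sigma>)) vs) ! j = vs ! (if \<sigma> j < i then \<sigma> j else Suc (\<sigma> j))"
      using j n by (simp add: nth_tl permute_list_def h_def L_def Z_def del: upt_Suc)
    also have "\<dots> = d i ! \<sigma> j"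
      using s that n by (auto simp: d_def nth_append min_def)
    finally show "tl (permute_list (h (i, \<sigma>)) vs) ! j = permute_list \<sigma> (d i) ! j"
      using j dn by (simp add: permute_list_def)
  qed
  have "simplicial_boundary (elementary_chain g vs) =
      (\<Sum>\<pi>\<in>T. Poly_Mapping.single (tl (permute_list \<pi> vs)) (if evenperm \<pi> then g else - g))"
    unfolding elementary_chain_def T_def n
    by (subst simplicial_boundary_sum)
       (use assms in \<open>auto simp: finite_permutations simplicial_boundary_single\<close>)
  also have "\<dots> = (\<Sum>x\<in>S. Poly_Mapping.single (tl (permute_list (h x) vs))
                                (if evenperm (h x) then g else - g))"
    unfolding hS [symmetric] by (rule sum.reindex [OF inj, unfolded o_def])
  also have "\<dots> = (\<Sum>(i, \<sigma>)\<in>S. Poly_Mapping.single (permute_list \<sigma> (d i))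
                 (if evenperm \<sigma> then if even i then g else - g else - (if even i then g else - g)))"
    by (rule sum.cong) (auto simp: S_def tl ev)
  also have "\<dots> = (\<Sum>i<Suc n. elementary_chain (if even i then g else - g) (d i))"
    unfolding S_def
    by (subst sum.cartesian_product [symmetric])
       (auto simp: elementary_chain_def d_def n intro!: sum.cong)
  finally show ?thesis by (simp add: n d_def)
qed

end

theory Submission
  imports Defs "HOL-Library.Disjoint_Sets"
begin

text \<open>
  The theorem has a geometric part and a formal part.

  The geometric part shows that the clusters of one bin for a large value of \<open>MinPts\<close> are
  contained in unique clusters of the same bin for a smaller value. Among core points
  density-reachability is symmetric, because the distance is, and hence an equivalence relation.
  If no point is a free-border point, then a point reachable from two core points forces these
  to be reachable from each other; so the cluster of a core point \<open>p\<close> is exactly the set of all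
  points density-reachable from \<open>p\<close>, whatever the order in which the clusters were produced
  (lemma \<open>cluster_eq_reachable\<close>). This set can only grow when \<open>MinPts\<close> decreases. Since the
  clusters of one bin are disjoint and nonempty, the larger cluster is unique, and
  uniqueness makes the resulting maps compose correctly (lemma \<open>cover_filtration_unique\<close>).

  The formal part is the functoriality of the nerve and of simplicial homology. A map of covers
  with \<open>U\<^sub>\<alpha> \<subseteq> V\<^bsub>u \<alpha>\<^esub>\<close> can only enlarge intersections, so it is simplicial on nerves. The boundary
  operator and the chain map of a vertex map are both of the form ``move the coefficient of each
  simplex \<open>x\<close> with \<open>Q x\<close> to \<open>h x\<close>'', and such operators compose in the evident way. The two
  identities \<open>\<partial>\<partial> = 0\<close> and \<open>\<partial> f\<^sub># = f\<^sub># \<partial>\<close> then both hold because the terms not cancelling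
  trivially come in pairs: exchanging two vertices of a simplex changes the sign of its
  coefficient but not its image. Pairing terms, instead of showing that a sum equals its own
  negative, is what makes the argument valid for coefficient groups with \<open>2\<close>-torsion.
\<close>

section \<open>Clusters without free-border points\<close>

lemma core_point_directly_reachable_self:
  assumes "core_point \<epsilon> M Y p" and "M > 0"
  shows "directly_density_reachable \<epsilon> M Y p p"
proof -
  have "eps_nbhd \<epsilon> Y p \<noteq> {}"
    using assms by (auto simp: core_point_def)
  \<comment> \<open>a nonempty neighbourhood forces \<open>\<epsilon> \<ge> 0\<close>\<close>
  then obtain q where "dist p q \<le> \<epsilon>"
    by (auto simp: eps_nbhd_def)
  then have "dist p p \<le> \<epsilon>"
    using zero_le_dist [of p q] by (simp del: zero_le_dist)
  then show ?thesis
    using assms by (simp add: directly_density_reachable_def core_point_def eps_nbhd_def)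
qed

lemma density_reachable_trans:
  "density_reachable \<epsilon> M Y p q \<Longrightarrow> density_reachable \<epsilon> M Y q r \<Longrightarrow> density_reachable \<epsilon> M Y p r"
  unfolding density_reachable_def by (rule tranclp_trans)

lemma density_reachable_last:
  assumes "density_reachable \<epsilon> M Y p q" and "M > 0"
  shows "\<exists>c. core_point \<epsilon> M Y c \<and> q \<in> eps_nbhd \<epsilon> Y c \<and> density_reachable \<epsilon> M Y p c"
  using assms(1) unfolding density_reachable_def
proof (cases rule: tranclp.cases)
  case r_into_trancl
  then have "directly_density_reachable \<epsilon> M Y p p"
    using core_point_directly_reachable_self [of \<epsilon> M Y p] \<open>M > 0\<close>
    unfolding directly_density_reachable_def by blast
  then show "\<exists>c. core_point \<epsilon> M Y c \<and> q \<in> eps_nbhd \<epsilon> Y c \<and>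
      (directly_density_reachable \<epsilon> M Y)\<^sup>+\<^sup>+ p c"
    using r_into_trancl unfolding directly_density_reachable_def by blast
next
  case (trancl_into_trancl c)
  then show "\<exists>c. core_point \<epsilon> M Y c \<and> q \<in> eps_nbhd \<epsilon> Y c \<and>
      (directly_density_reachable \<epsilon> M Y)\<^sup>+\<^sup>+ p c"
    by (auto simp: directly_density_reachable_def)
qed

text \<open>All points of a chain except the last are core points, and between core points each single
  step can be reversed.\<close>

lemma density_reachable_core_sym:
  assumes "density_reachable \<epsilon> M Y p q" and "core_point \<epsilon> M Y q"
  shows "density_reachable \<epsilon> M Y q p"
  using assms unfolding density_reachable_def
proof (induction rule: tranclp_induct)
  case (base q)
  then have "directly_density_reachable \<epsilon> M Y q p"
    by (auto simp: directly_density_reachable_def core_point_def eps_nbhd_def dist_commute)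
  then show ?case ..
next
  case (step q r)
  then have "directly_density_reachable \<epsilon> M Y r q" and "core_point \<epsilon> M Y q"
    by (auto simp: directly_density_reachable_def core_point_def eps_nbhd_def dist_commute)
  then show ?case
    using step.IH by (meson tranclp_into_tranclp2)
qed

lemma density_connected_core:
  assumes "density_connected \<epsilon> M Y p q" and "core_point \<epsilon> M Y p"
  shows "density_reachable \<epsilon> M Y p q"
proof -
  obtain r where r: "density_reachable \<epsilon> M Y r p" "density_reachable \<epsilon> M Y r q"
    using assms(1) by (auto simp: density_connected_def)
  show ?thesis
    using density_reachable_core_sym [OF r(1) assms(2)] r(2) by (rule density_reachable_trans)
qed

text \<open>The last steps of the two chains start at core points near \<open>q\<close>. If \<open>q\<close> is not itself core,
  these must be density-connected, since otherwise \<open>q\<close> would be a free-border point.\<close>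

lemma reachable_from_two_cores:
  assumes p: "density_reachable \<epsilon> M Y p q" and p': "density_reachable \<epsilon> M Y p' q"
    and nofree: "\<not> free_border_point \<epsilon> M Y q" and "M > 0"
  shows "density_reachable \<epsilon> M Y p p'"
proof -
  obtain c c' where c: "core_point \<epsilon> M Y c" "q \<in> eps_nbhd \<epsilon> Y c" "density_reachable \<epsilon> M Y p c"
    and c': "core_point \<epsilon> M Y c'" "q \<in> eps_nbhd \<epsilon> Y c'" "density_reachable \<epsilon> M Y p' c'"
    using density_reachable_last [OF p \<open>M > 0\<close>] density_reachable_last [OF p' \<open>M > 0\<close>] by blast
  have from_c': "density_reachable \<epsilon> M Y c' p'"
    using c' by (blast intro: density_reachable_core_sym)
  show ?thesis
  proof (cases "core_point \<epsilon> M Y q")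
    case True
    then show ?thesis
      using p p' by (blast intro: density_reachable_core_sym density_reachable_trans)
  next
    case False
    have "q \<in> Y" using c(2) by (simp add: eps_nbhd_def)
    then have "density_connected \<epsilon> M Y c c'"
      using False nofree c c' unfolding free_border_point_def core_point_def
      by (metis not_less)
    then have "density_reachable \<epsilon> M Y c c'"
      using c(1) by (rule density_connected_core)
    then show ?thesis
      using c(3) from_c' by (blast intro: density_reachable_trans)
  qed
qed

lemma density_reachable_in: "density_reachable \<epsilon> M Y p q \<Longrightarrow> q \<in> Y"
  unfolding density_reachable_def
  by (erule tranclp.cases) (auto simp: directly_density_reachable_def eps_nbhd_def)

lemma density_reachable_not_noise:
  assumes "density_reachable \<epsilon> M Y p q" and "M > 0"
  shows "q \<notin> noise_points \<epsilon> M Y"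
  using density_reachable_last [OF assms] density_reachable_in [OF assms(1)]
  by (auto simp: noise_points_def border_point_def)

lemma dbscan_clustered:
  assumes "dbscan_output \<epsilon> M Y Cs" "p \<in> Y" "p \<notin> noise_points \<epsilon> M Y"
  obtains C where "C \<in> set Cs" "p \<in> C"
proof -
  have "\<Union>(set Cs) \<union> noise_points \<epsilon> M Y = Y"
    using assms(1) by (simp add: dbscan_output_def)
  then show ?thesis using assms(2,3) that by blast
qed

lemma dbscan_cluster_core:
  assumes "dbscan_output \<epsilon> M Y Cs" "C \<in> set Cs"
  obtains p where "p \<in> C" "core_point \<epsilon> M Y p"
  using assms by (auto simp: dbscan_output_def)

lemma dbscan_maximal:
  assumes "dbscan_output \<epsilon> M Y Cs" "i < length Cs" "p \<in> Cs ! i" "q \<notin> (\<Union>j<i. Cs ! j)"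
    and "density_reachable \<epsilon> M Y p q"
  shows "q \<in> Cs ! i"
proof -
  have "\<forall>i<length Cs. \<forall>p q. p \<in> Cs ! i \<and> q \<notin> (\<Union>j<i. Cs ! j) \<and> density_reachable \<epsilon> M Y p q
      \<longrightarrow> q \<in> Cs ! i"
    using assms(1) unfolding dbscan_output_def by (elim conjE)
  from this [rule_format, OF assms(2)] show ?thesis using assms(3-) by blast
qed

lemma dbscan_connected:
  assumes "dbscan_output \<epsilon> M Y Cs" "C \<in> set Cs" "p \<in> C" "q \<in> C"
  shows "density_connected \<epsilon> M Y p q"
proof -
  have "\<forall>C\<in>set Cs. \<forall>p\<in>C. \<forall>q\<in>C. density_connected \<epsilon> M Y p q"
    using assms(1) unfolding dbscan_output_def by (elim conjE)
  then show ?thesis using assms(2-) by simp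
qed

lemma dbscan_disjoint_nth:
  assumes "dbscan_output \<epsilon> M Y Cs" "i < length Cs" "j < length Cs" "x \<in> Cs ! i" "x \<in> Cs ! j"
  shows "i = j"
proof -
  have "\<forall>i<length Cs. \<forall>j<length Cs. i \<noteq> j \<longrightarrow> Cs ! i \<inter> Cs ! j = {}"
    using assms(1) by (simp add: dbscan_output_def)
  then show ?thesis using assms(2-) by blast
qed

lemma dbscan_disjoint:
  assumes "dbscan_output \<epsilon> M Y Cs" "C \<in> set Cs" "D \<in> set Cs" "x \<in> C" "x \<in> D"
  shows "C = D"
  using assms(2-) dbscan_disjoint_nth [OF assms(1)] by (auto simp: in_set_conv_nth)

text \<open>Maximality speaks only about points not in an earlier cluster. When the two clusters
  contain core points reachable from each other, this restriction is harmless for the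
  earlier one of the two.\<close>

lemma dbscan_reachable_cores_same_cluster:
  assumes db: "dbscan_output \<epsilon> M Y Cs" and C: "C \<in> set Cs" "p \<in> C" and D: "D \<in> set Cs" "q \<in> D"
    and pq: "density_reachable \<epsilon> M Y p q" and qp: "density_reachable \<epsilon> M Y q p"
  shows "C = D"
proof -
  obtain i j where i: "i < length Cs" "C = Cs ! i" and j: "j < length Cs" "D = Cs ! j"
    using C D by (metis in_set_conv_nth)
  have first: "y \<notin> (\<Union>l<k. Cs ! l)" if "k \<le> n" "n < length Cs" "y \<in> Cs ! n" for k n y
  proof
    assume "y \<in> (\<Union>l<k. Cs ! l)"
    then obtain l where "l < k" "y \<in> Cs ! l" by blast
    then show False
      using dbscan_disjoint_nth [OF db, of l n y] that by simp
  qed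
  consider "i \<le> j" | "j \<le> i" by linarith
  then show ?thesis
  proof cases
    case 1
    then have "q \<in> C"
      using dbscan_maximal [OF db i(1) _ first pq] i j C D by blast
    then show ?thesis using dbscan_disjoint [OF db] C D by blast
  next
    case 2
    then have "p \<in> D"
      using dbscan_maximal [OF db j(1) _ first qp] i j C D by blast
    then show ?thesis using dbscan_disjoint [OF db] C D by blast
  qed
qed

text \<open>A point \<open>q\<close> reachable from \<open>p\<close> is not noise, so it lies in some cluster \<open>D\<close> and is reachable
  from a core point of \<open>D\<close> as well. The two core points are then reachable from each other,
  and \<open>D\<close> is the cluster of \<open>p\<close>.\<close>

lemma cluster_eq_reachable:
  assumes db: "dbscan_output \<epsilon> M Y Cs" and "C \<in> set Cs" "p \<in> C" and p: "core_point \<epsilon> M Y p"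
    and "M > 0" and nofree: "\<And>s. \<not> free_border_point \<epsilon> M Y s"
  shows "C = {q. density_reachable \<epsilon> M Y p q}"
proof (intro equalityI subsetI CollectI)
  have conn: "density_reachable \<epsilon> M Y x y"
    if "D \<in> set Cs" "x \<in> D" "y \<in> D" "core_point \<epsilon> M Y x" for D x y
    using dbscan_connected [OF db that(1-3)] that(4) by (rule density_connected_core)
  show "density_reachable \<epsilon> M Y p q" if "q \<in> C" for q
    using assms(2,3) that p by (rule conn)
  fix q assume "q \<in> {q. density_reachable \<epsilon> M Y p q}"
  then have q: "density_reachable \<epsilon> M Y p q" by simp
  have "q \<in> Y" "q \<notin> noise_points \<epsilon> M Y"
    using density_reachable_in [OF q] density_reachable_not_noise [OF q \<open>M > 0\<close>] .
  then obtain D where D: "D \<in> set Cs" "q \<in> D"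
    by (rule dbscan_clustered [OF db])
  obtain d where d: "d \<in> D" "core_point \<epsilon> M Y d"
    by (rule dbscan_cluster_core [OF db D(1)])
  have "density_reachable \<epsilon> M Y d q"
    using D(1) d(1) D(2) d(2) by (rule conn)
  then have "density_reachable \<epsilon> M Y p d" "density_reachable \<epsilon> M Y d p"
    using reachable_from_two_cores q nofree \<open>M > 0\<close> by blast+
  then have "C = D"
    by (rule dbscan_reachable_cores_same_cluster [OF db assms(2,3) D(1) d(1)])
  then show "q \<in> C" using D by simp
qed

lemma core_point_antimono: "core_point \<epsilon> M Y p \<Longrightarrow> M' \<le> M \<Longrightarrow> core_point \<epsilon> M' Y p"
  by (auto simp: core_point_def)

lemma density_reachable_antimono:
  assumes "density_reachable \<epsilon> M Y p q" and "M' \<le> M"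
  shows "density_reachable \<epsilon> M' Y p q"
proof -
  have mono: "directly_density_reachable \<epsilon> M' Y x y"
    if "directly_density_reachable \<epsilon> M Y x y" for x y
    using that core_point_antimono [OF _ \<open>M' \<le> M\<close>] by (auto simp: directly_density_reachable_def)
  show ?thesis
    using assms(1) unfolding density_reachable_def
  proof (induction rule: tranclp_induct)
    case (base y)
    then show ?case using mono by blast
  next
    case (step y z)
    then show ?case using mono [OF step.hyps(2)] by (metis tranclp.trancl_into_trancl)
  qed
qed

text \<open>A core point \<open>p\<close> of \<open>C\<close> is still core, hence clustered, for \<open>M'\<close>. Its two clusters are the
  sets of points reachable from \<open>p\<close>, and every chain for \<open>M\<close> is a chain for \<open>M'\<close>.\<close>

theorem cluster_contained_in_cluster:
  assumes db: "dbscan_output \<epsilon> M Y Cs" and db': "dbscan_output \<epsilon> M' Y Cs'"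
    and "0 < M'" "M' \<le> M"
    and nofree: "\<And>s. \<not> free_border_point \<epsilon> M Y s" "\<And>s. \<not> free_border_point \<epsilon> M' Y s"
    and C: "C \<in> set Cs"
  shows "\<exists>!D. D \<in> set Cs' \<and> C \<subseteq> D"
proof -
  obtain p where p: "p \<in> C" "core_point \<epsilon> M Y p"
    by (rule dbscan_cluster_core [OF db C])
  have p': "core_point \<epsilon> M' Y p"
    using p \<open>M' \<le> M\<close> by (blast intro: core_point_antimono)
  then have "p \<in> Y" "p \<notin> noise_points \<epsilon> M' Y"
    by (auto simp: core_point_def noise_points_def)
  then obtain D where D: "D \<in> set Cs'" "p \<in> D"
    by (rule dbscan_clustered [OF db'])
  have "C = {q. density_reachable \<epsilon> M Y p q}"
    using cluster_eq_reachable [OF db C p] nofree(1) \<open>0 < M'\<close> \<open>M' \<le> M\<close> by simp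
  also have "\<dots> \<subseteq> {q. density_reachable \<epsilon> M' Y p q}"
    using density_reachable_antimono [OF _ \<open>M' \<le> M\<close>] by blast
  also have "\<dots> = D"
    using cluster_eq_reachable [OF db' D p' \<open>0 < M'\<close> nofree(2)] by simp
  finally show ?thesis
    using D p(1) dbscan_disjoint [OF db'] by blast
qed

section \<open>Filtrations of covers and nerves\<close>

text \<open>By transitivity of \<open>R\<close> and \<open>E\<close>, the member selected in one step from \<open>l\<close> to \<open>n\<close> and the
  one obtained in two steps through \<open>m\<close> both qualify for the given member, so they agree. The
  relation \<open>E\<close> on indices restricts which members may be compared; for cluster covers it says that
  two clusters come from the same bin. As bins may overlap, the larger cluster would not be unique
  without it.\<close>

lemma cover_filtration_unique:
  assumes uniq: "\<And>l m \<alpha>. l \<in> P \<Longrightarrow> m \<in> P \<Longrightarrow> R l m \<Longrightarrow> \<alpha> \<in> A l \<Longrightarrow>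
      \<exists>!\<beta>. \<beta> \<in> A m \<and> E \<alpha> \<beta> \<and> U l \<alpha> \<subseteq> U m \<beta>"
    and "transp E" "transp R"
  shows "\<exists>u. cover_filtration P R A U u"
proof -
  define u where "u l m \<alpha> = (THE \<beta>. \<beta> \<in> A m \<and> E \<alpha> \<beta> \<and> U l \<alpha> \<subseteq> U m \<beta>)" for l m \<alpha>
  have u: "u l m \<alpha> \<in> A m" "E \<alpha> (u l m \<alpha>)" "U l \<alpha> \<subseteq> U m (u l m \<alpha>)"
    if "l \<in> P" "m \<in> P" "R l m" "\<alpha> \<in> A l" for l m \<alpha>
    using theI' [OF uniq [OF that]] by (simp_all add: u_def)
  have "u m n (u l m \<alpha>) = u l n \<alpha>"
    if lmn: "l \<in> P" "m \<in> P" "n \<in> P" "R l m" "R m n" and \<alpha>: "\<alpha> \<in> A l" for l m n \<alpha>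
  proof -
    note lm = u [OF lmn(1,2,4) \<alpha>]
    note mn = u [OF lmn(2,3,5) lm(1)]
    have "R l n" using lmn \<open>transp R\<close> by (blast dest: transpD)
    note ln = u [OF lmn(1,3) this \<alpha>] and uniq [OF lmn(1,3) this \<alpha>]
    moreover have "E \<alpha> (u m n (u l m \<alpha>))"
      using lm(2) mn(2) \<open>transp E\<close> by (blast dest: transpD)
    moreover have "U l \<alpha> \<subseteq> U n (u m n (u l m \<alpha>))"
      using lm(3) mn(3) by (rule subset_trans)
    ultimately show ?thesis
      using mn(1) by blast
  qed
  then have "cover_filtration P R A U u"
    using u unfolding cover_filtration_def by (simp add: Pi_iff)
  then show ?thesis by blast
qed

lemma simplicial_complex_nerve:
  assumes "\<And>\<alpha>. \<alpha> \<in> A \<Longrightarrow> U \<alpha> \<noteq> {}"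
  shows "simplicial_complex (nerve A U)"
  unfolding simplicial_complex_def
proof (intro conjI ballI allI impI)
  fix s t assume "s \<in> simplices (nerve A U)" and t: "t \<subseteq> s \<and> t \<noteq> {}"
  then have s: "s \<subseteq> A" "finite s" "(\<Inter>\<alpha>\<in>s. U \<alpha>) \<noteq> {}"
    by (auto simp: nerve_def)
  have "(\<Inter>\<alpha>\<in>s. U \<alpha>) \<subseteq> (\<Inter>\<alpha>\<in>t. U \<alpha>)" using t by blast
  then show "t \<in> simplices (nerve A U)"
    using s t by (auto simp: nerve_def intro: finite_subset)
qed (use assms in \<open>auto simp: nerve_def\<close>)

lemma simplicial_map_nerve:
  assumes "u \<in> A \<rightarrow> B" and "\<And>\<alpha>. \<alpha> \<in> A \<Longrightarrow> U \<alpha> \<subseteq> V (u \<alpha>)"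
  shows "simplicial_map (nerve A U) (nerve B V) u"
  unfolding simplicial_map_def
proof (intro conjI ballI)
  fix s assume "s \<in> simplices (nerve A U)"
  then have s: "s \<subseteq> A" "finite s" "s \<noteq> {}" "(\<Inter>\<alpha>\<in>s. U \<alpha>) \<noteq> {}"
    by (auto simp: nerve_def)
  then have "(\<Inter>\<alpha>\<in>s. U \<alpha>) \<subseteq> (\<Inter>\<beta>\<in>u ` s. V \<beta>)"
    using assms(2) by blast
  moreover have "u ` s \<subseteq> B"
    using s(1) assms(1) by auto
  ultimately show "u ` s \<in> simplices (nerve B V)"
    using s by (auto simp: nerve_def)
qed (use assms(1) in \<open>simp add: nerve_def\<close>)

lemma simplicial_filtration_nerve:
  assumes "cover_filtration P R A U u" and "\<And>l \<alpha>. l \<in> P \<Longrightarrow> \<alpha> \<in> A l \<Longrightarrow> U l \<alpha> \<noteq> {}"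
  shows "simplicial_filtration P R (\<lambda>l. nerve (A l) (U l)) u"
  unfolding simplicial_filtration_def
proof (intro conjI ballI impI)
  show "simplicial_complex (nerve (A l) (U l))" if "l \<in> P" for l
    by (rule simplicial_complex_nerve) (rule assms(2) [OF that])
  show "simplicial_map (nerve (A l) (U l)) (nerve (A m) (U m)) (u l m)"
    if "l \<in> P" "m \<in> P" "R l m" for l m
    using that assms(1) by (intro simplicial_map_nerve) (simp_all add: cover_filtration_def)
  show "u m n (u l m v) = u l n v"
    if "l \<in> P" "m \<in> P" "n \<in> P" "R l m \<and> R m n" "v \<in> vertices (nerve (A l) (U l))" for l m n v
    using that assms(1) by (simp add: cover_filtration_def nerve_def)
qed

section \<open>Alternating chains and their images\<close>

abbreviation (input) chain_coeff :: "('x \<Rightarrow>\<^sub>0 'g::zero) \<Rightarrow> 'x \<Rightarrow> 'g" where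
  "chain_coeff \<equiv> Poly_Mapping.lookup"

text \<open>Boundary and chain maps are both instances of this operator, for \<open>h = tl\<close> and
  \<open>h = map f\<close>.\<close>

definition push_forward ::
    "('x \<Rightarrow> bool) \<Rightarrow> ('x \<Rightarrow> 'y) \<Rightarrow> ('x \<Rightarrow>\<^sub>0 'g::ab_group_add) \<Rightarrow> ('y \<Rightarrow>\<^sub>0 'g)" where
  "push_forward Q h c =
     (\<Sum>x\<in>Poly_Mapping.keys c. if Q x then Poly_Mapping.single (h x) (chain_coeff c x) else 0)"

lemma simplicial_boundary_eq_push_forward:
  "simplicial_boundary = push_forward (\<lambda>vs. 2 \<le> length vs) tl"
  by (simp add: fun_eq_iff simplicial_boundary_def push_forward_def)

lemma simplicial_chain_map_eq_push_forward:
  "simplicial_chain_map f = push_forward (\<lambda>vs. distinct (map f vs)) (map f)"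
  by (simp add: fun_eq_iff simplicial_chain_map_def push_forward_def)

lemma push_forward_0 [simp]: "push_forward Q h 0 = 0"
  by (simp add: push_forward_def)

lemma push_forward_add: "push_forward Q h (a + b) = push_forward Q h a + push_forward Q h b"
  unfolding push_forward_def by (rule sum_keys_single_add)

lemma push_forward_uminus: "push_forward Q h (- a) = - push_forward Q h a"
  using push_forward_add [of Q h a "- a"] by (simp add: eq_neg_iff_add_eq_0 add.commute)

lemma push_forward_sum:
  "finite I \<Longrightarrow> push_forward Q h (\<Sum>i\<in>I. c i) = (\<Sum>i\<in>I. push_forward Q h (c i))"
  by (induction I rule: finite_induct) (simp_all add: push_forward_add)

lemma push_forward_single:
  "push_forward Q h (Poly_Mapping.single x g) = (if Q x then Poly_Mapping.single (h x) g else 0)"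
  by (simp add: push_forward_def)

lemma push_forward_push_forward:
  "push_forward Q' h' (push_forward Q h c) = push_forward (\<lambda>x. Q x \<and> Q' (h x)) (\<lambda>x. h' (h x)) c"
proof -
  have "push_forward Q' h' (push_forward Q h c) =
      (\<Sum>x\<in>Poly_Mapping.keys c. push_forward Q' h'
         (if Q x then Poly_Mapping.single (h x) (chain_coeff c x) else 0))"
    by (subst push_forward_def [of Q h]) (simp add: push_forward_sum)
  also have "\<dots> = push_forward (\<lambda>x. Q x \<and> Q' (h x)) (\<lambda>x. h' (h x)) c"
    unfolding push_forward_def [of "\<lambda>x. Q x \<and> Q' (h x)"]
    by (rule sum.cong) (auto simp: push_forward_single)
  finally show ?thesis .
qed

lemma push_forward_cong:
  assumes "\<And>x. x \<in> Poly_Mapping.keys c \<Longrightarrow> Q x \<longleftrightarrow> Q' x"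
    and "\<And>x. x \<in> Poly_Mapping.keys c \<Longrightarrow> Q x \<Longrightarrow> h x = h' x"
  shows "push_forward Q h c = push_forward Q' h' c"
  unfolding push_forward_def using assms by (intro sum.cong) auto

lemma push_forward_split:
  "push_forward Q h c = push_forward (\<lambda>x. Q x \<and> S x) h c + push_forward (\<lambda>x. Q x \<and> \<not> S x) h c"
  unfolding push_forward_def sum.distrib [symmetric] by (rule sum.cong) auto

lemma lookup_push_forward:
  "chain_coeff (push_forward Q h c) y =
     (\<Sum>x | x \<in> Poly_Mapping.keys c \<and> Q x \<and> h x = y. chain_coeff c x)"
proof -
  have "chain_coeff (push_forward Q h c) y =
      (\<Sum>x\<in>Poly_Mapping.keys c. if Q x \<and> h x = y then chain_coeff c x else 0)"
    unfolding push_forward_def lookup_sum by (rule sum.cong) (auto simp: lookup_single)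
  then show ?thesis
    by (simp add: sum.inter_filter [symmetric])
qed

lemma keys_push_forward:
  "Poly_Mapping.keys (push_forward Q h c) \<subseteq> h ` {x \<in> Poly_Mapping.keys c. Q x}"
proof
  fix y assume "y \<in> Poly_Mapping.keys (push_forward Q h c)"
  then have "(\<Sum>x | x \<in> Poly_Mapping.keys c \<and> Q x \<and> h x = y. chain_coeff c x) \<noteq> 0"
    by (simp add: in_keys_iff lookup_push_forward)
  then obtain x where "x \<in> Poly_Mapping.keys c" "Q x" "h x = y"
    by (metis (mono_tags, lifting) mem_Collect_eq sum.neutral)
  then show "y \<in> h ` {x \<in> Poly_Mapping.keys c. Q x}" by blast
qed

definition alternating :: "('v list \<Rightarrow>\<^sub>0 'g::ab_group_add) \<Rightarrow> bool" where
  "alternating c \<longleftrightarrow> (\<forall>vs \<pi>. \<pi> permutes {..<length vs} \<longrightarrow>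
     chain_coeff c (permute_list \<pi> vs) = (if evenperm \<pi> then chain_coeff c vs else - chain_coeff c vs))"

lemma in_simplicial_chains_iff:
  "c \<in> simplicial_chains K p \<longleftrightarrow>
     (\<forall>vs\<in>Poly_Mapping.keys c. distinct vs \<and> set vs \<in> simplices K \<and> int (length vs) = p + 1) \<and>
     alternating c"
  by (simp add: simplicial_chains_def alternating_def)

lemma alternating_permute_keys:
  assumes "alternating c" "\<pi> permutes {..<length vs}" "vs \<in> Poly_Mapping.keys c"
  shows "permute_list \<pi> vs \<in> Poly_Mapping.keys c"
  using assms unfolding alternating_def in_keys_iff by simp

lemma permute_list_permute_list_inv:
  assumes "\<pi> permutes {..<length vs}"
  shows "permute_list (inv_into UNIV \<pi>) (permute_list \<pi> vs) = vs"
proof -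
  have "permute_list (inv_into UNIV \<pi>) (permute_list \<pi> vs) = permute_list (\<pi> \<circ> inv_into UNIV \<pi>) vs"
    using permutes_inv [OF assms] by (simp add: permute_list_compose)
  then show ?thesis using permutes_inv_o(1) [OF assms] by simp
qed

text \<open>\<open>L\<close> lifts a permutation of the image \<open>h vs\<close> to one of \<open>vs\<close> with the same sign. It then maps
  the fibre of \<open>h\<close> over \<open>ws\<close> bijectively onto the fibre over the permuted \<open>ws\<close> and multiplies
  the coefficients by the sign.\<close>

lemma alternating_push_forward:
  fixes h :: "'v list \<Rightarrow> 'w list"
  assumes c: "alternating c"
    and L: "\<And>vs \<pi>. vs \<in> Poly_Mapping.keys c \<Longrightarrow> Q vs \<Longrightarrow> \<pi> permutes {..<length (h vs)} \<Longrightarrow>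
       L \<pi> permutes {..<length vs} \<and> evenperm (L \<pi>) = evenperm \<pi> \<and>
       Q (permute_list (L \<pi>) vs) \<and> h (permute_list (L \<pi>) vs) = permute_list \<pi> (h vs)"
  shows "alternating (push_forward Q h c)"
  unfolding alternating_def
proof (intro allI impI)
  define F where "F ws = {vs. vs \<in> Poly_Mapping.keys c \<and> Q vs \<and> h vs = ws}" for ws :: "'w list"
  have fin: "finite (F ws)" for ws
    by (simp add: F_def)
  have into: "permute_list (L \<pi>) ` F ws \<subseteq> F (permute_list \<pi> ws)"
    if "\<pi> permutes {..<length ws}" for \<pi> ws
    using that L c by (auto simp: F_def intro: alternating_permute_keys)
  have inj: "inj_on (permute_list (L \<pi>)) (F ws)" if "\<pi> permutes {..<length ws}" for \<pi> ws
  proof (rule inj_on_inverseI)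
    fix vs assume "vs \<in> F ws"
    then show "permute_list (inv_into UNIV (L \<pi>)) (permute_list (L \<pi>) vs) = vs"
      using that L by (intro permute_list_permute_list_inv) (auto simp: F_def)
  qed
  fix ws :: "'w list" and \<pi> assume \<pi>: "\<pi> permutes {..<length ws}"
  let ?ws = "permute_list \<pi> ws"
  have \<pi>': "inv_into UNIV \<pi> permutes {..<length ?ws}"
    using permutes_inv [OF \<pi>] by simp
  have "card (F ?ws) \<le> card (F ws)"
    using card_inj_on_le [OF inj [OF \<pi>'] into [OF \<pi>'] fin]
    by (simp only: permute_list_permute_list_inv [OF \<pi>])
  then have "card (permute_list (L \<pi>) ` F ws) = card (F ?ws)"
    using card_image [OF inj [OF \<pi>]] card_mono [OF fin into [OF \<pi>]] by linarith
  then have "permute_list (L \<pi>) ` F ws = F ?ws"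
    using fin into [OF \<pi>] by (intro card_subset_eq)
  then have "(\<Sum>vs\<in>F ?ws. chain_coeff c vs) =
      (\<Sum>vs\<in>F ws. chain_coeff c (permute_list (L \<pi>) vs))"
    using sum.reindex [OF inj [OF \<pi>], of "chain_coeff c"] by simp
  also have "\<dots> = (\<Sum>vs\<in>F ws. if evenperm \<pi> then chain_coeff c vs else - chain_coeff c vs)"
  proof (rule sum.cong [OF refl])
    fix vs assume "vs \<in> F ws"
    then have "L \<pi> permutes {..<length vs}" "evenperm (L \<pi>) = evenperm \<pi>"
      using L \<pi> by (auto simp: F_def)
    then show "chain_coeff c (permute_list (L \<pi>) vs) =
        (if evenperm \<pi> then chain_coeff c vs else - chain_coeff c vs)"
      using c unfolding alternating_def by metis
  qed
  also have "\<dots> = (if evenperm \<pi> then \<Sum>vs\<in>F ws. chain_coeff c vs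
                    else - (\<Sum>vs\<in>F ws. chain_coeff c vs))"
    by (simp add: sum_negf)
  finally show "chain_coeff (push_forward Q h c) ?ws =
      (if evenperm \<pi> then chain_coeff (push_forward Q h c) ws
       else - chain_coeff (push_forward Q h c) ws)"
    unfolding lookup_push_forward F_def .
qed

text \<open>If exchanging the first vertex of a simplex with another one does not change its image, the
  contributions cancel in pairs. The partner is determined by the index \<open>i (h' vs)\<close>, where
  \<open>h' vs\<close> is itself unchanged by the exchange, so that the exchange is an involution.\<close>

lemma push_forward_swap_eq_0:
  assumes c: "alternating c"
    and dist: "\<And>vs. vs \<in> Poly_Mapping.keys c \<Longrightarrow> distinct vs"
    and swap: "\<And>vs. vs \<in> Poly_Mapping.keys c \<Longrightarrow> Q vs \<Longrightarrow>
       0 < i (h' vs) \<and> i (h' vs) < length vs \<and>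
       (let ws = permute_list (transpose 0 (i (h' vs))) vs in Q ws \<and> h ws = h vs \<and> h' ws = h' vs)"
  shows "push_forward Q h c = 0"
proof -
  define S where "S = {vs \<in> Poly_Mapping.keys c. Q vs}"
  define t where "t vs = transpose 0 (i (h' vs))" for vs
  define \<sigma> where "\<sigma> vs = permute_list (t vs) vs" for vs
  have perm: "t vs permutes {..<length vs}" "\<not> evenperm (t vs)" if "vs \<in> S" for vs
    using swap [of vs] that
    by (auto simp: S_def t_def evenperm_swap intro!: permutes_swap_id)
  have same: "h (\<sigma> vs) = h vs" "t (\<sigma> vs) = t vs" if "vs \<in> S" for vs
    using swap [of vs] that by (auto simp: S_def \<sigma>_def t_def Let_def)
  have closed: "\<sigma> vs \<in> S" if "vs \<in> S" for vs
    using swap [of vs] that alternating_permute_keys [OF c perm(1) [OF that]]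
    by (auto simp: S_def \<sigma>_def t_def Let_def)
  have invol: "\<sigma> (\<sigma> vs) = vs" if "vs \<in> S" for vs
  proof -
    have "\<sigma> (\<sigma> vs) = permute_list (t vs) (permute_list (t vs) vs)"
      using same(2) [OF that] by (simp add: \<sigma>_def)
    also have "\<dots> = permute_list (t vs \<circ> t vs) vs"
      by (rule permute_list_compose [symmetric]) (rule perm [OF that])
    finally show ?thesis by (simp add: t_def)
  qed
  have moved: "\<sigma> vs \<noteq> vs" if "vs \<in> S" for vs
  proof
    assume "\<sigma> vs = vs"
    then have "vs ! 0 = vs ! (i (h' vs))"
      using permute_list_nth [OF perm(1) [OF that], of 0] swap [of vs] that
      unfolding S_def \<sigma>_def t_def by (simp del: length_greater_0_conv)
    moreover have "vs ! 0 \<noteq> vs ! (i (h' vs))"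
      using swap [of vs] that dist [of vs] by (subst nth_eq_iff_index_eq) (auto simp: S_def)
    ultimately show False by simp
  qed
  have cancel: "Poly_Mapping.single (h (\<sigma> vs)) (chain_coeff c (\<sigma> vs)) +
      Poly_Mapping.single (h vs) (chain_coeff c vs) = 0" if "vs \<in> S" for vs
  proof -
    have "chain_coeff c (\<sigma> vs) = - chain_coeff c vs"
      using c perm [OF that] unfolding alternating_def \<sigma>_def by metis
    then show ?thesis
      by (simp add: same that single_uminus)
  qed
  have "push_forward Q h c = (\<Sum>vs\<in>S. Poly_Mapping.single (h vs) (chain_coeff c vs))"
    unfolding push_forward_def S_def by (simp add: sum.inter_filter)
  also have "\<dots> = 0"
    using cancel closed invol moved by (rule sum_involution_eq_0)
  finally show ?thesis .
qed

section \<open>The simplicial chain complex\<close>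

lemma simplicial_boundary_in_chains:
  assumes K: "simplicial_complex K" and c: "c \<in> simplicial_chains K p"
  shows "simplicial_boundary c \<in> simplicial_chains K (p - 1)"
  unfolding in_simplicial_chains_iff
proof (intro conjI ballI)
  have ckeys: "distinct vs \<and> set vs \<in> simplices K \<and> int (length vs) = p + 1"
    if "vs \<in> Poly_Mapping.keys c" for vs
    using c that by (simp add: in_simplicial_chains_iff)
  fix ws assume "ws \<in> Poly_Mapping.keys (simplicial_boundary c)"
  then obtain vs where vs: "vs \<in> Poly_Mapping.keys c" "2 \<le> length vs" "ws = tl vs"
    using keys_push_forward unfolding simplicial_boundary_eq_push_forward by fastforce
  have sub: "set ws \<subseteq> set vs" "set ws \<noteq> {}"
    using vs by (cases vs; cases "tl vs"; auto)+
  show "distinct ws" using ckeys [OF vs(1)] vs by (simp add: distinct_tl)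
  show "set ws \<in> simplices K"
    using ckeys [OF vs(1)] K sub unfolding simplicial_complex_def by blast
  show "int (length ws) = p - 1 + 1" using ckeys [OF vs(1)] vs by auto
next
  show "alternating (simplicial_boundary c)"
    unfolding simplicial_boundary_eq_push_forward
  proof (rule alternating_push_forward)
    show "alternating c" using c by (simp add: in_simplicial_chains_iff)
    let ?L = "\<lambda>\<pi> (j::nat). case j of 0 \<Rightarrow> 0 | Suc i \<Rightarrow> Suc (\<pi> i)"
    fix vs :: "'a list" and \<pi> :: "nat \<Rightarrow> nat"
    assume len: "2 \<le> length vs" and \<pi>: "\<pi> permutes {..<length (tl vs)}"
    then obtain v ws where vs: "vs = v # ws" by (cases vs) auto
    have "?L \<pi> permutes {..<length vs} \<and> (evenperm (?L \<pi>) \<longleftrightarrow> evenperm \<pi>)"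
      using shift_permutes \<pi> vs by fastforce
    moreover have "permute_list (?L \<pi>) vs = v # permute_list \<pi> ws"
      by (simp add: vs permute_list_def upt_conv_Cons map_Suc_upt [symmetric] del: upt_Suc)
    ultimately show "?L \<pi> permutes {..<length vs} \<and> evenperm (?L \<pi>) = evenperm \<pi> \<and>
        2 \<le> length (permute_list (?L \<pi>) vs) \<and> tl (permute_list (?L \<pi>) vs) = permute_list \<pi> (tl vs)"
      using len vs by simp
  qed
qed

lemma simplicial_chain_map_in_chains:
  assumes f: "simplicial_map K L f" and c: "c \<in> simplicial_chains K p"
  shows "simplicial_chain_map f c \<in> simplicial_chains L p"
  unfolding in_simplicial_chains_iff
proof (intro conjI ballI)
  fix ws assume "ws \<in> Poly_Mapping.keys (simplicial_chain_map f c)"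
  then obtain vs where vs: "vs \<in> Poly_Mapping.keys c" "distinct (map f vs)" "ws = map f vs"
    using keys_push_forward unfolding simplicial_chain_map_eq_push_forward by fastforce
  then have "set vs \<in> simplices K" "int (length vs) = p + 1"
    using c by (simp_all add: in_simplicial_chains_iff)
  then show "distinct ws" "set ws \<in> simplices L" "int (length ws) = p + 1"
    using f vs by (simp_all add: simplicial_map_def)
next
  have "alternating c" using c by (simp add: in_simplicial_chains_iff)
  then show "alternating (simplicial_chain_map f c)"
    unfolding simplicial_chain_map_eq_push_forward
  proof (rule alternating_push_forward [where L = "\<lambda>\<pi>. \<pi>"])
    fix vs :: "'a list" and \<pi> :: "nat \<Rightarrow> nat"
    assume "distinct (map f vs)" "\<pi> permutes {..<length (map f vs)}"
    then show "\<pi> permutes {..<length vs} \<and> evenperm \<pi> = evenperm \<pi> \<and>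
        distinct (map f (permute_list \<pi> vs)) \<and>
        map f (permute_list \<pi> vs) = permute_list \<pi> (map f vs)"
      by (metis distinct_permute_list length_map permute_list_map)
  qed
qed

text \<open>\<open>\<partial>\<partial>\<close> deletes the first two vertices, so exchanging these does not change the image.\<close>

lemma simplicial_boundary_boundary:
  assumes "c \<in> simplicial_chains K p"
  shows "simplicial_boundary (simplicial_boundary c) = 0"
  unfolding simplicial_boundary_eq_push_forward push_forward_push_forward
proof (rule push_forward_swap_eq_0 [where i = "\<lambda>_. 1" and h' = "\<lambda>_. ()"])
  show "alternating c" "\<And>vs. vs \<in> Poly_Mapping.keys c \<Longrightarrow> distinct vs"
    using assms by (auto simp: in_simplicial_chains_iff)
  fix vs :: "'a list" assume "2 \<le> length vs \<and> 2 \<le> length (tl vs)"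
  moreover from this obtain v w ws where vs: "vs = v # w # ws"
    by (cases vs; cases "tl vs") auto
  moreover have "permute_list (transpose 0 1) vs = w # v # ws"
  proof (rule nth_equalityI)
    fix j assume "j < length (permute_list (transpose 0 1) vs)"
    then show "permute_list (transpose 0 1) vs ! j = (w # v # ws) ! j"
      by (cases j; cases "j - 1")
         (auto simp: vs permute_list_def transpose_def nth_append simp del: upt_Suc)
  qed (simp add: vs)
  ultimately show "0 < (1::nat) \<and> 1 < length vs \<and>
      (let ws = permute_list (transpose 0 1) vs
       in (2 \<le> length ws \<and> 2 \<le> length (tl ws)) \<and> tl (tl ws) = tl (tl vs) \<and> () = ())"
    by simp
qed

text \<open>A simplex on which \<open>f\<close> is injective contributes the same to both sides. The only other
  contributions are to \<open>f\<^sub># \<partial>\<close>, from simplices whose first vertex has the same image as exactly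
  one other vertex; exchanging these two vertices shows that they cancel.\<close>

lemma simplicial_boundary_chain_map:
  fixes f :: "'v \<Rightarrow> 'w"
  assumes c: "c \<in> simplicial_chains K p"
  shows "simplicial_boundary (simplicial_chain_map f c) =
    simplicial_chain_map f (simplicial_boundary c)"
proof -
  let ?Q = "\<lambda>vs. 2 \<le> length vs \<and> distinct (map f (tl vs))"
  let ?h = "\<lambda>vs. map f (tl vs)"
  define i where "i us = (SOME j. 0 < j \<and> j < length us \<and> us ! j = us ! 0)" for us :: "'w list"
  have "push_forward (\<lambda>vs. ?Q vs \<and> \<not> distinct (map f vs)) ?h c = 0"
  proof (rule push_forward_swap_eq_0 [where i = i and h' = "map f"])
    show "alternating c" "\<And>vs. vs \<in> Poly_Mapping.keys c \<Longrightarrow> distinct vs"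
      using c by (auto simp: in_simplicial_chains_iff)
    fix vs assume vs: "?Q vs \<and> \<not> distinct (map f vs)"
    then obtain v us where v: "vs = v # us" by (cases vs) auto
    then have "f v \<in> set (map f us)" using vs by auto
    then obtain j where "j < length us" "map f us ! j = f v"
      by (metis in_set_conv_nth length_map)
    then have "0 < Suc j \<and> Suc j < length (map f vs) \<and> map f vs ! Suc j = map f vs ! 0"
      by (simp add: v)
    then have i: "0 < i (map f vs)" "i (map f vs) < length (map f vs)"
        "map f vs ! i (map f vs) = map f vs ! 0"
      unfolding i_def by (metis (mono_tags, lifting) someI_ex)+
    let ?t = "transpose 0 (i (map f vs))"
    have t: "?t permutes {..<length vs}"
      using i by (intro permutes_swap_id) auto
    have "map f (permute_list ?t vs) = permute_list ?t (map f vs)"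
      using t by (simp add: permute_list_map)
    also have "\<dots> = map f vs"
    proof (rule nth_equalityI)
      fix j assume "j < length (permute_list ?t (map f vs))"
      then have "permute_list ?t (map f vs) ! j = map f vs ! ?t j"
        using t by (intro permute_list_nth) auto
      also have "\<dots> = map f vs ! j"
        using i(3) by (simp add: transpose_def)
      finally show "permute_list ?t (map f vs) ! j = map f vs ! j" .
    qed simp
    finally have same: "map f (permute_list ?t vs) = map f vs" .
    then show "0 < i (map f vs) \<and> i (map f vs) < length vs \<and>
        (let ws = permute_list ?t vs
         in (?Q ws \<and> \<not> distinct (map f ws)) \<and> ?h ws = ?h vs \<and> map f ws = map f vs)"
      using i vs by (simp add: map_tl)
  qed
  moreover have "push_forward ?Q ?h c =
      push_forward (\<lambda>vs. ?Q vs \<and> distinct (map f vs)) ?h c +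
      push_forward (\<lambda>vs. ?Q vs \<and> \<not> distinct (map f vs)) ?h c"
    by (rule push_forward_split)
  moreover have "push_forward (\<lambda>vs. ?Q vs \<and> distinct (map f vs)) ?h c =
      push_forward (\<lambda>vs. distinct (map f vs) \<and> 2 \<le> length (map f vs)) (\<lambda>vs. tl (map f vs)) c"
    by (rule push_forward_cong) (auto simp: map_tl distinct_tl)
  ultimately show ?thesis
    unfolding simplicial_boundary_eq_push_forward simplicial_chain_map_eq_push_forward
      push_forward_push_forward by simp
qed

lemma simplicial_chain_map_compose:
  "simplicial_chain_map g (simplicial_chain_map f c) = simplicial_chain_map (\<lambda>v. g (f v)) c"
  unfolding simplicial_chain_map_eq_push_forward push_forward_push_forward
  by (rule push_forward_cong) (auto simp: distinct_map inj_on_def comp_def)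

lemma simplicial_chain_map_cong:
  assumes K: "simplicial_complex K" and c: "c \<in> simplicial_chains K p"
    and "\<And>v. v \<in> vertices K \<Longrightarrow> f v = g v"
  shows "simplicial_chain_map f c = simplicial_chain_map g c"
proof -
  have "map f vs = map g vs" if "vs \<in> Poly_Mapping.keys c" for vs
    using that assms unfolding in_simplicial_chains_iff simplicial_complex_def
    by (intro map_cong) (auto 4 4)
  then show ?thesis
    unfolding simplicial_chain_map_eq_push_forward by (intro push_forward_cong) metis+
qed

section \<open>Functoriality of simplicial homology\<close>

lemma simplicial_chains_0: "0 \<in> simplicial_chains K p"
  by (simp add: in_simplicial_chains_iff alternating_def)

lemma simplicial_chains_add:
  "a \<in> simplicial_chains K p \<Longrightarrow> b \<in> simplicial_chains K p \<Longrightarrow> a + b \<in> simplicial_chains K p"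
  using keys_add [of a b] unfolding in_simplicial_chains_iff alternating_def
  by (auto simp: lookup_add)

lemma simplicial_chains_uminus:
  "a \<in> simplicial_chains K p \<Longrightarrow> - a \<in> simplicial_chains K p"
  unfolding in_simplicial_chains_iff alternating_def by (auto simp: in_keys_iff)

lemma simplicial_boundary_uminus: "simplicial_boundary (- c) = - simplicial_boundary c"
  unfolding simplicial_boundary_eq_push_forward by (rule push_forward_uminus)

lemma simplicial_boundary_0: "simplicial_boundary 0 = 0"
  by (simp add: simplicial_boundary_eq_push_forward)

lemma in_simplicial_cycles_iff:
  "c \<in> simplicial_cycles K p \<longleftrightarrow> c \<in> simplicial_chains K p \<and> simplicial_boundary c = 0"
  by (simp add: simplicial_cycles_def kernel_def simplicial_chain_group_def)

lemma simplicial_cycle_group_simps [simp]: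
  "carrier (simplicial_cycle_group K p) = simplicial_cycles K p"
  "a \<otimes>\<^bsub>simplicial_cycle_group K p\<^esub> b = a + b"
  "\<one>\<^bsub>simplicial_cycle_group K p\<^esub> = 0"
  by (simp_all add: simplicial_cycle_group_def simplicial_chain_group_def)

lemma comm_group_simplicial_cycle_group:
  fixes K :: "'v scomplex"
  shows "comm_group (simplicial_cycle_group K p :: ('v list \<Rightarrow>\<^sub>0 'g::ab_group_add) monoid)"
proof (rule comm_groupI)
  fix a :: "'v list \<Rightarrow>\<^sub>0 'g" assume "a \<in> carrier (simplicial_cycle_group K p)"
  then show "\<exists>b\<in>carrier (simplicial_cycle_group K p).
      b \<otimes>\<^bsub>simplicial_cycle_group K p\<^esub> a = \<one>\<^bsub>simplicial_cycle_group K p\<^esub>"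
    by (intro bexI [of _ "- a"])
       (auto simp: in_simplicial_cycles_iff simplicial_chains_uminus simplicial_boundary_uminus)
qed (auto simp: in_simplicial_cycles_iff simplicial_chains_add simplicial_chains_0
       simplicial_boundary_add simplicial_boundary_0 ac_simps)

lemma subgroup_simplicial_boundaries:
  fixes K :: "'v scomplex"
  assumes "simplicial_complex K"
  shows "subgroup (simplicial_boundaries K p)
    (simplicial_cycle_group K p :: ('v list \<Rightarrow>\<^sub>0 'g::ab_group_add) monoid)"
proof -
  interpret comm_group "simplicial_cycle_group K p :: ('v list \<Rightarrow>\<^sub>0 'g) monoid"
    by (rule comm_group_simplicial_cycle_group)
  show ?thesis
  proof (rule subgroupI)
    show sub: "(simplicial_boundaries K p :: ('v list \<Rightarrow>\<^sub>0 'g) set) \<subseteq>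
        carrier (simplicial_cycle_group K p)"
      using simplicial_boundary_in_chains [OF assms, of _ "p + 1"]
      using simplicial_boundary_boundary
      by (fastforce simp: simplicial_boundaries_def in_simplicial_cycles_iff)
    show "(simplicial_boundaries K p :: ('v list \<Rightarrow>\<^sub>0 'g) set) \<noteq> {}"
      using simplicial_chains_0 by (auto simp: simplicial_boundaries_def)
    fix a :: "'v list \<Rightarrow>\<^sub>0 'g" assume a: "a \<in> simplicial_boundaries K p"
    then have neg: "- a \<in> simplicial_boundaries K p"
      unfolding simplicial_boundaries_def
      by (metis (mono_tags, lifting) image_iff simplicial_boundary_uminus simplicial_chains_uminus)
    then have "inv\<^bsub>simplicial_cycle_group K p\<^esub> a = - a"
      using a sub by (intro inv_equality) auto
    then show "inv\<^bsub>simplicial_cycle_group K p\<^esub> a \<in> simplicial_boundaries K p"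
      using neg by simp
    fix b :: "'v list \<Rightarrow>\<^sub>0 'g" assume "b \<in> simplicial_boundaries K p"
    then show "a \<otimes>\<^bsub>simplicial_cycle_group K p\<^esub> b \<in> simplicial_boundaries K p"
      using a unfolding simplicial_boundaries_def
      by (auto simp: simplicial_boundary_add [symmetric] intro: simplicial_chains_add)
  qed
qed

abbreviation homology_class ::
    "'v scomplex \<Rightarrow> int \<Rightarrow> ('v list \<Rightarrow>\<^sub>0 'g::ab_group_add) \<Rightarrow> ('v list \<Rightarrow>\<^sub>0 'g) set" where
  "homology_class K p c \<equiv> simplicial_boundaries K p #>\<^bsub>simplicial_cycle_group K p\<^esub> c"

lemma comm_group_simplicial_homology:
  "simplicial_complex K \<Longrightarrow> comm_group (simplicial_homology K p)"
  unfolding simplicial_homology_def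
  by (intro comm_group.abelian_FactGroup comm_group_simplicial_cycle_group
        subgroup_simplicial_boundaries)

lemma carrier_simplicial_homology:
  "carrier (simplicial_homology K p) = homology_class K p ` simplicial_cycles K p"
  by (auto simp: simplicial_homology_def FactGroup_def RCOSETS_def)

lemma mult_simplicial_homology:
  assumes "simplicial_complex K" "a \<in> simplicial_cycles K p" "b \<in> simplicial_cycles K p"
  shows "homology_class K p a \<otimes>\<^bsub>simplicial_homology K p\<^esub> homology_class K p b =
    homology_class K p (a + b)"
proof -
  have "simplicial_boundaries K p \<lhd> simplicial_cycle_group K p"
    using comm_group.subgroup_imp_normal comm_group_simplicial_cycle_group
      subgroup_simplicial_boundaries [OF assms(1)] by blast
  from normal.rcos_sum [OF this, of a b] show ?thesis
    using assms by (simp add: simplicial_homology_def FactGroup_def)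
qed

lemma simplicial_chain_map_cycle:
  assumes "simplicial_map K L f" "c \<in> simplicial_cycles K p"
  shows "simplicial_chain_map f c \<in> simplicial_cycles L p"
proof -
  have "simplicial_boundary (simplicial_chain_map f c) = simplicial_chain_map f 0"
    using assms simplicial_boundary_chain_map by (metis in_simplicial_cycles_iff)
  also have "\<dots> = 0"
    by (simp add: simplicial_chain_map_eq_push_forward)
  finally show ?thesis
    using assms by (auto simp: in_simplicial_cycles_iff intro: simplicial_chain_map_in_chains)
qed

lemma simplicial_chain_map_boundary:
  assumes "simplicial_map K L f" "c \<in> simplicial_boundaries K p"
  shows "simplicial_chain_map f c \<in> simplicial_boundaries L p"
proof -
  obtain d where d: "d \<in> simplicial_chains K (p + 1)" "c = simplicial_boundary d"
    using assms(2) by (auto simp: simplicial_boundaries_def)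
  then have "simplicial_chain_map f c = simplicial_boundary (simplicial_chain_map f d)"
    by (simp add: simplicial_boundary_chain_map)
  then show ?thesis
    using simplicial_chain_map_in_chains [OF assms(1) d(1)] by (auto simp: simplicial_boundaries_def)
qed

text \<open>The union in the definition of the induced map is over equal cosets, because a boundary is
  mapped to a boundary.\<close>

lemma simplicial_hom_induced_class:
  fixes c :: "'v list \<Rightarrow>\<^sub>0 'g::ab_group_add" and L :: "'w scomplex"
  assumes L: "simplicial_complex L" and K: "simplicial_complex K" and f: "simplicial_map K L f"
    and c: "c \<in> simplicial_cycles K p"
  shows "simplicial_hom_induced L p f (homology_class K p c) =
    homology_class L p (simplicial_chain_map f c)"
proof -
  interpret L: comm_group "simplicial_cycle_group L p :: ('w list \<Rightarrow>\<^sub>0 'g) monoid"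
    by (rule comm_group_simplicial_cycle_group)
  interpret K: comm_group "simplicial_cycle_group K p :: ('v list \<Rightarrow>\<^sub>0 'g) monoid"
    by (rule comm_group_simplicial_cycle_group)
  have "homology_class L p (simplicial_chain_map f c') = homology_class L p (simplicial_chain_map f c)"
    if c': "c' \<in> homology_class K p c" for c' :: "'v list \<Rightarrow>\<^sub>0 'g"
  proof -
    obtain b where b: "b \<in> simplicial_boundaries K p" "c' = b + c"
      using c' by (auto simp: r_coset_def)
    have "simplicial_chain_map f c' \<in> homology_class L p (simplicial_chain_map f c)"
      using simplicial_chain_map_boundary [OF f b(1)]
      by (auto simp: r_coset_def b(2) simplicial_chain_map_add)
    then show ?thesis
      using L.repr_independence subgroup_simplicial_boundaries [OF L]
        simplicial_chain_map_cycle [OF f c] by (metis simplicial_cycle_group_simps(1))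
  qed
  moreover have "c \<in> homology_class K p c"
    using c by (simp add: K.rcos_self subgroup_simplicial_boundaries [OF K])
  ultimately show ?thesis
    unfolding simplicial_hom_induced_def by blast
qed

theorem group_filtration_simplicial_homology:
  fixes K :: "'p \<Rightarrow> 'v scomplex"
  assumes "simplicial_filtration P R K \<phi>"
  shows "group_filtration P R (\<lambda>l. simplicial_homology (K l) p)
    (\<lambda>l m. simplicial_hom_induced (K m) p (\<phi> l m)
       :: ('v list \<Rightarrow>\<^sub>0 'g::ab_group_add) set \<Rightarrow> ('v list \<Rightarrow>\<^sub>0 'g) set)"
proof -
  have K: "simplicial_complex (K l)" if "l \<in> P" for l
    using assms that by (simp add: simplicial_filtration_def)
  have \<phi>: "simplicial_map (K l) (K m) (\<phi> l m)" if "l \<in> P" "m \<in> P" "R l m" for l m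
    using assms that by (simp add: simplicial_filtration_def)
  note induced = simplicial_hom_induced_class [OF K K \<phi>]
  have "(simplicial_hom_induced (K m) p (\<phi> l m) ::
      ('v list \<Rightarrow>\<^sub>0 'g) set \<Rightarrow> ('v list \<Rightarrow>\<^sub>0 'g) set) \<in>
      hom (simplicial_homology (K l) p) (simplicial_homology (K m) p)"
    if lm: "l \<in> P" "m \<in> P" "R l m" for l m
  proof (rule homI; (unfold carrier_simplicial_homology, clarify)?)
    fix a b :: "'v list \<Rightarrow>\<^sub>0 'g" assume ab: "a \<in> simplicial_cycles (K l) p" "b \<in> simplicial_cycles (K l) p"
    note cycle = simplicial_chain_map_cycle [OF \<phi> [OF lm]]
    show "simplicial_hom_induced (K m) p (\<phi> l m) (homology_class (K l) p a)
        \<in> homology_class (K m) p ` simplicial_cycles (K m) p"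
      using induced lm ab(1) cycle by (metis imageI)
    have "a + b \<in> simplicial_cycles (K l) p"
      using ab by (simp add: in_simplicial_cycles_iff simplicial_chains_add simplicial_boundary_add)
    then show "simplicial_hom_induced (K m) p (\<phi> l m)
          (homology_class (K l) p a \<otimes>\<^bsub>simplicial_homology (K l) p\<^esub> homology_class (K l) p b) =
        simplicial_hom_induced (K m) p (\<phi> l m) (homology_class (K l) p a)
          \<otimes>\<^bsub>simplicial_homology (K m) p\<^esub>
        simplicial_hom_induced (K m) p (\<phi> l m) (homology_class (K l) p b)"
      using ab lm cycle [OF ab(1)] cycle [OF ab(2)] K
      by (simp add: mult_simplicial_homology induced simplicial_chain_map_add)
  qed
  moreover have "simplicial_hom_induced (K n) p (\<phi> m n) (simplicial_hom_induced (K m) p (\<phi> l m) z) =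
      simplicial_hom_induced (K n) p (\<phi> l n) z"
    if lmn: "l \<in> P" "m \<in> P" "n \<in> P" "R l m" "R m n"
      and z: "z \<in> carrier (simplicial_homology (K l) p)" for l m n and z :: "('v list \<Rightarrow>\<^sub>0 'g) set"
  proof -
    obtain c where c: "c \<in> simplicial_cycles (K l) p" "z = homology_class (K l) p c"
      using z by (auto simp: carrier_simplicial_homology)
    have comp: "\<phi> m n (\<phi> l m v) = \<phi> l n v" if "v \<in> vertices (K l)" for v
      using assms lmn that unfolding simplicial_filtration_def by blast
    \<comment> \<open>since \<open>R l n\<close> is not given, \<open>\<phi> l n\<close> is shown to be simplicial as a composite\<close>
    have ln: "simplicial_map (K l) (K n) (\<phi> l n)"
    proof -
      have "\<phi> l n ` s = \<phi> m n ` (\<phi> l m ` s)" if "s \<in> simplices (K l)" for s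
      proof -
        have "s \<subseteq> vertices (K l)"
          using K [OF lmn(1)] that by (simp add: simplicial_complex_def)
        then show ?thesis
          using comp by (force simp: image_image intro!: image_cong)
      qed
      then show ?thesis
        using \<phi> [OF lmn(1,2,4)] \<phi> [OF lmn(2,3,5)] comp unfolding simplicial_map_def
        by (auto simp: Pi_iff) metis
    qed
    have "simplicial_hom_induced (K n) p (\<phi> m n) (simplicial_hom_induced (K m) p (\<phi> l m) z) =
        homology_class (K n) p (simplicial_chain_map (\<lambda>v. \<phi> m n (\<phi> l m v)) c)"
      using c lmn simplicial_chain_map_cycle [OF \<phi> [OF lmn(1,2,4)] c(1)]
      by (simp add: induced simplicial_chain_map_compose)
    also have "\<dots> = homology_class (K n) p (simplicial_chain_map (\<phi> l n) c)"
      using simplicial_chain_map_cong [OF K [OF lmn(1)], of c p] c comp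
      by (metis (no_types, lifting) in_simplicial_cycles_iff)
    also have "\<dots> = simplicial_hom_induced (K n) p (\<phi> l n) z"
      using c lmn by (simp add: simplicial_hom_induced_class [OF K K ln])
    finally show ?thesis .
  qed
  ultimately show ?thesis
    by (simp add: group_filtration_def comm_group_simplicial_homology K)
qed

section \<open>The filtration for decreasing \<open>MinPts\<close>\<close>

theorem theorem8:
  fixes X :: "'a::metric_space set" and B :: "'b set" and bin :: "'b \<Rightarrow> 'a set"
    and \<epsilon> :: real and k :: int and MinPts :: "nat \<Rightarrow> nat" and m :: nat
    and Cl :: "nat \<Rightarrow> 'b \<Rightarrow> 'a set list"
  assumes "finite X"
    and "finite B" and "(\<Union>b\<in>B. bin b) = X"
    and "\<And>i. i \<le> m \<Longrightarrow> MinPts i > 0"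
    and "\<And>i. i < m \<Longrightarrow> MinPts i \<ge> MinPts (Suc i)"
    and "\<And>i b. i \<le> m \<Longrightarrow> b \<in> B \<Longrightarrow> dbscan_output \<epsilon> (MinPts i) (bin b) (Cl (MinPts i) b)"
    and "\<And>i b s. i \<le> m \<Longrightarrow> b \<in> B \<Longrightarrow> \<not> free_border_point \<epsilon> (MinPts i) (bin b) s"
  shows "let P = MinPts ` {..m};
             C = (\<lambda>M. cluster_cover B (Cl M));
             K = (\<lambda>M. nerve (C M) snd)
         in \<exists>u \<phi>.
              cover_filtration P (\<ge>) C (\<lambda>M. snd) u \<and>
              simplicial_filtration P (\<ge>) K \<phi> \<and>
              simplicial_filtration_induced P (\<ge>) K u \<phi> \<and>
              (\<exists>f :: nat \<Rightarrow> nat \<Rightarrow> (('b \<times> 'a set) list \<Rightarrow>\<^sub>0 'g::ab_group_add) set \<Rightarrow> _.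
                 group_filtration P (\<ge>) (\<lambda>M. simplicial_homology (K M) k) f \<and>
                 homology_filtration_induced P (\<ge>) K k \<phi> f)"
proof -
  define P where "P = MinPts ` {..m}"
  define C where "C = (\<lambda>M. cluster_cover B (Cl M))"
  define K where "K = (\<lambda>M. nerve (C M) snd)"
  have pos: "0 < M" if "M \<in> P" for M
    using that assms(4) by (auto simp: P_def)
  have db: "dbscan_output \<epsilon> M (bin b) (Cl M b)" if "M \<in> P" "b \<in> B" for M b
    using that assms(6) by (auto simp: P_def)
  have nofree: "\<not> free_border_point \<epsilon> M (bin b) s" if "M \<in> P" "b \<in> B" for M b s
    using that assms(7) by (auto simp: P_def)
  have uniq: "\<exists>!\<beta>. \<beta> \<in> C M' \<and> fst \<alpha> = fst \<beta> \<and> snd \<alpha> \<subseteq> snd \<beta>"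
    if M: "M \<in> P" "M' \<in> P" "M \<ge> M'" and \<alpha>: "\<alpha> \<in> C M" for M M' and \<alpha> :: "'b \<times> 'a set"
  proof -
    obtain b D where b: "\<alpha> = (b, D)" "b \<in> B" "D \<in> set (Cl M b)"
      using \<alpha> by (auto simp: C_def cluster_cover_def)
    have ex1: "\<exists>!D'. D' \<in> set (Cl M' b) \<and> D \<subseteq> D'"
      using db nofree pos M b by (intro cluster_contained_in_cluster [of \<epsilon> M "bin b" "Cl M b" M']) auto
    then obtain D' where D': "D' \<in> set (Cl M' b)" "D \<subseteq> D'" by blast
    show ?thesis
    proof (rule ex1I [of _ "(b, D')"])
      show "(b, D') \<in> C M' \<and> fst \<alpha> = fst (b, D') \<and> snd \<alpha> \<subseteq> snd (b, D')"
        using b D' by (simp add: C_def cluster_cover_def)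
      fix \<beta> assume \<beta>: "\<beta> \<in> C M' \<and> fst \<alpha> = fst \<beta> \<and> snd \<alpha> \<subseteq> snd \<beta>"
      obtain E where E: "\<beta> = (b, E)" "E \<in> set (Cl M' b)" "D \<subseteq> E"
        using \<beta> b by (cases \<beta>) (simp add: C_def cluster_cover_def)
      then have "E = D'" using ex1 D' by blast
      then show "\<beta> = (b, D')" using E by simp
    qed
  qed
  have "\<exists>u. cover_filtration P (\<ge>) C (\<lambda>M. snd) u"
  proof (rule cover_filtration_unique [where E = "\<lambda>\<alpha> \<beta>. fst \<alpha> = fst \<beta>"])
    show "transp (\<lambda>\<alpha> \<beta>. fst \<alpha> = fst (\<beta> :: 'b \<times> 'a set))" "transp ((\<ge>) :: nat \<Rightarrow> nat \<Rightarrow> bool)"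
      by (auto simp: transp_def)
  qed (rule uniq)
  then obtain u where u: "cover_filtration P (\<ge>) C (\<lambda>M. snd) u" by blast
  have "snd \<alpha> \<noteq> {}" if "M \<in> P" "\<alpha> \<in> C M" for M and \<alpha> :: "'b \<times> 'a set"
  proof -
    have "fst \<alpha> \<in> B" "snd \<alpha> \<in> set (Cl M (fst \<alpha>))"
      using that(2) by (auto simp: C_def cluster_cover_def)
    then show ?thesis
      using dbscan_cluster_core [OF db [OF that(1)]] by blast
  qed
  then have K: "simplicial_filtration P (\<ge>) K u"
    using simplicial_filtration_nerve [OF u] by (simp add: K_def)
  have "\<exists>f :: nat \<Rightarrow> nat \<Rightarrow> (('b \<times> 'a set) list \<Rightarrow>\<^sub>0 'g) set \<Rightarrow> _.
      group_filtration P (\<ge>) (\<lambda>M. simplicial_homology (K M) k) f \<and>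
      homology_filtration_induced P (\<ge>) K k u f"
    using group_filtration_simplicial_homology [OF K]
    by (intro exI [of _ "\<lambda>l m. simplicial_hom_induced (K m) k (u l m)"])
       (simp add: homology_filtration_induced_def)
  then have "\<exists>u \<phi>.
      cover_filtration P (\<ge>) C (\<lambda>M. snd) u \<and>
      simplicial_filtration P (\<ge>) K \<phi> \<and>
      simplicial_filtration_induced P (\<ge>) K u \<phi> \<and>
      (\<exists>f :: nat \<Rightarrow> nat \<Rightarrow> (('b \<times> 'a set) list \<Rightarrow>\<^sub>0 'g) set \<Rightarrow> _.
         group_filtration P (\<ge>) (\<lambda>M. simplicial_homology (K M) k) f \<and>
         homology_filtration_induced P (\<ge>) K k \<phi> f)"
    using u K by (intro exI [of _ u]) (simp add: simplicial_filtration_induced_def)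
  then show ?thesis
    by (simp only: Let_def P_def C_def K_def)
qed

end
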